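(* Let $\varphi$ be a free holomorphic self-map of the noncommutative ball $[B(\mathcal H)^n]_1$. Then the composition operator $C_\varphi$ on $H^2_{\bf ball}$ is normal if and only if $$\varphi(X_1,\ldots,X_n)=[X_1,\ldots,X_n]A,\qquad (X_1,\ldots,X_n)\in[B(\mathcal H)^n]_1,$$ for some normal scalar matrix $A\in M_{n\times n}(\mathbb C)$ with $\|A\|\le1$.
   Context: $n\ge1$; $\mathcal H$ is a separable infinite dimensional complex Hilbert space. $\mathbb F_n^+$ is the free semigroup with generators $g_1,\ldots,g_n$ and identity $g_0$; $|g_0|=0$, $|\alpha|=k$ if $\alpha=g_{i_1}\cdots g_{i_k}$; $X_\alpha:=X_{i_1}\cdots X_{i_k}$, $X_{g_0}:=I$. $[B(\mathcal H)^n]_1:=\{(X_1,\ldots,X_n)\in B(\mathcal H)^n:\ \|X_1X_1^*+\cdots+X_nX_n^*\|^{1/2}<1\}$. A free holomorphic function $f:[B(\mathcal H)^n]_1\to B(\mathcal H)$ is a map $f(X)=\sum_{k=0}^\infty\sum_{|\alpha|=k}a_\alpha X_\alpha$ (series over $k$ converging in operator norm) with $a_\alpha\in\mathbb C$ and $\limsup_{k\to\infty}(\sum_{|\alpha|=k}|a_\alpha|^2)^{1/2k}\le1$. A free holomorphic self-map $\varphi=(\varphi_1,\ldots,\varphi_n)$ of $[B(\mathcal H)^n]_1$ has each $\varphi_i$ free holomorphic and maps $[B(\mathcal H)^n]_1$ into itself. With $\varphi_\alpha:=\varphi_{i_1}\cdots\varphi_{i_k}$, the composition is $(f\circ\varphi)(X)=\sum_{k=0}^\infty\sum_{|\alpha|=k}a_\alpha\varphi_\alpha(X)$.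 $H^2_{\bf ball}$ is the Hilbert space of free holomorphic functions $f=\sum_\alpha a_\alpha X_\alpha$ on $[B(\mathcal H)^n]_1$ with $\|f\|_2^2:=\sum_\alpha|a_\alpha|^2<\infty$; $C_\varphi f:=f\circ\varphi$ is a bounded operator on $H^2_{\bf ball}$. For $A=[a_{ij}]$, $[X_1,\ldots,X_n]A$ is the $n$-tuple whose $j$-th entry is $\sum_{i=1}^na_{ij}X_i$; $\|A\|$ is the operator norm on $\mathbb C^n$. *)

theory Defs
  imports "HOL-Analysis.Analysis"
begin

section \<open>Complex Hilbert spaces and their bounded operators\<close>

text \<open>The norm, metric and topology of a complex inner product space are those of the underlying
  real inner product space, whose inner product is the real part of \<open>cinner\<close>. Positive
  definiteness of \<open>cinner\<close> is thus inherited from \<^class>\<open>real_inner\<close>; \<open>cinner\<close> is linear in its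
  first argument.\<close>

class complex_inner = real_inner +
  fixes scaleC :: "complex \<Rightarrow> 'a \<Rightarrow> 'a"
    and cinner :: "'a \<Rightarrow> 'a \<Rightarrow> complex"
  assumes scaleC_add_right: "scaleC c (x + y) = scaleC c x + scaleC c y"
    and scaleC_add_left: "scaleC (c + d) x = scaleC c x + scaleC d x"
    and scaleC_scaleC: "scaleC c (scaleC d x) = scaleC (c * d) x"
    and scaleC_of_real: "scaleC (complex_of_real r) x = scaleR r x"
    and cinner_commute: "cinner x y = cnj (cinner y x)"
    and cinner_add_left: "cinner (x + y) z = cinner x z + cinner y z"
    and cinner_scaleC_left: "cinner (scaleC c x) y = c * cinner x y"
    and inner_eq_Re_cinner: "inner x y = Re (cinner x y)"

class complex_hilbert = complex_inner + complete_space

lemma norm_scaleC: "norm (scaleC c (x::'h::complex_inner)) = cmod c * norm x"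
proof -
  have "cinner (scaleC c x) (scaleC c x) = c * cnj c * cinner x x"
    by (metis cinner_commute cinner_scaleC_left complex_cnj_mult mult.assoc)
  also have "\<dots> = complex_of_real ((cmod c)\<^sup>2) * cinner x x"
    by (simp only: complex_norm_square)
  finally have "inner (scaleC c x) (scaleC c x) = (cmod c)\<^sup>2 * inner x x"
    by (simp add: inner_eq_Re_cinner del: of_real_power)
  then show ?thesis
    by (simp add: norm_eq_sqrt_inner real_sqrt_mult)
qed

text \<open>Elements of \<open>'h \<Rightarrow>\<^sub>L 'h\<close> are only real-linear; \<open>cblinops\<close> is the algebra $B(\mathcal H)$ of
  bounded complex-linear operators. The norm of \<open>'h \<Rightarrow>\<^sub>L 'h\<close> is the operator norm.\<close>

definition cblinops :: "('h::complex_hilbert \<Rightarrow>\<^sub>L 'h) set" where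
  "cblinops = {T. \<forall>c x. blinfun_apply T (scaleC c x) = scaleC c (blinfun_apply T x)}"

lift_definition cscale :: "complex \<Rightarrow> ('h::complex_hilbert \<Rightarrow>\<^sub>L 'h) \<Rightarrow> ('h \<Rightarrow>\<^sub>L 'h)" is
  "\<lambda>c T x. scaleC c (T x)"
proof -
  fix c :: complex and T :: "'h \<Rightarrow> 'h"
  assume "bounded_linear T"
  moreover have "bounded_linear (scaleC c :: 'h \<Rightarrow> 'h)"
  proof (rule bounded_linear_intro[where K = "cmod c"])
    fix r :: real and x :: 'h
    show "scaleC c (scaleR r x) = scaleR r (scaleC c x)"
      by (simp add: scaleC_of_real[symmetric] scaleC_scaleC mult.commute)
  qed (simp_all add: scaleC_add_right norm_scaleC mult.commute)
  ultimately show "bounded_linear (\<lambda>x. scaleC c (T x))"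
    using bounded_linear_compose by blast
qed

definition op_adjoint :: "('h::complex_hilbert \<Rightarrow>\<^sub>L 'h) \<Rightarrow> ('h \<Rightarrow>\<^sub>L 'h)" where
  "op_adjoint T =
     (THE S. \<forall>x y. cinner (blinfun_apply T x) y = cinner x (blinfun_apply S y))"


section \<open>Free holomorphic functions on the noncommutative ball\<close>

definition nc_ball :: "(('h::complex_hilbert \<Rightarrow>\<^sub>L 'h) ^ 'n::finite) set" where
  "nc_ball = {X. (\<forall>i. X $ i \<in> cblinops) \<and>
                 sqrt (norm (\<Sum>i\<in>UNIV. X $ i o\<^sub>L op_adjoint (X $ i))) < 1}"

text \<open>The free semigroup on the generators indexed by \<open>'n\<close> is the type \<open>'n list\<close> of words, with
  length \<open>length\<close> and identity \<open>[]\<close>; \<open>word_prod X \<alpha>\<close> is $X_\alpha$.\<close>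

definition word_prod :: "('h::complex_hilbert \<Rightarrow>\<^sub>L 'h) ^ 'n::finite \<Rightarrow> 'n list \<Rightarrow> ('h \<Rightarrow>\<^sub>L 'h)" where
  "word_prod X \<alpha> = foldr (\<lambda>i T. X $ i o\<^sub>L T) \<alpha> id_blinfun"

definition has_free_series ::
  "(('h::complex_hilbert \<Rightarrow>\<^sub>L 'h) ^ 'n::finite \<Rightarrow> ('h \<Rightarrow>\<^sub>L 'h)) \<Rightarrow> ('n list \<Rightarrow> complex) \<Rightarrow> bool" where
  "has_free_series f a \<longleftrightarrow>
     limsup (\<lambda>k. ereal (root (2 * k) (\<Sum>\<alpha> | length \<alpha> = k. (cmod (a \<alpha>))\<^sup>2))) \<le> 1 \<and>
     (\<forall>X\<in>nc_ball. (\<lambda>k. \<Sum>\<alpha> | length \<alpha> = k. cscale (a \<alpha>) (word_prod X \<alpha>)) sums f X)"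

definition free_holomorphic ::
  "(('h::complex_hilbert \<Rightarrow>\<^sub>L 'h) ^ 'n::finite \<Rightarrow> ('h \<Rightarrow>\<^sub>L 'h)) \<Rightarrow> bool" where
  "free_holomorphic f \<longleftrightarrow> (\<exists>a. has_free_series f a)"

text \<open>The coefficients are unique when \<open>'h\<close> is infinite dimensional.\<close>

definition free_coeff ::
  "(('h::complex_hilbert \<Rightarrow>\<^sub>L 'h) ^ 'n::finite \<Rightarrow> ('h \<Rightarrow>\<^sub>L 'h)) \<Rightarrow> 'n list \<Rightarrow> complex" where
  "free_coeff f = (THE a. has_free_series f a)"

definition free_holomorphic_self_map ::
  "(('h::complex_hilbert \<Rightarrow>\<^sub>L 'h) ^ 'n::finite \<Rightarrow> ('h \<Rightarrow>\<^sub>L 'h) ^ 'n) \<Rightarrow> bool" where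
  "free_holomorphic_self_map \<phi> \<longleftrightarrow>
     (\<forall>i. free_holomorphic (\<lambda>X. \<phi> X $ i)) \<and> (\<forall>X\<in>nc_ball. \<phi> X \<in> nc_ball)"


section \<open>The Hardy space and its operators\<close>

text \<open>Elements of $H^2_{\bf ball}$ are functions on \<open>nc_ball\<close>, represented as total functions that
  are \<^const>\<open>undefined\<close> off the ball, so that equality in \<open>H2_ball\<close> is equality on the ball.\<close>

definition H2_ball ::
  "(('h::complex_hilbert \<Rightarrow>\<^sub>L 'h) ^ 'n::finite \<Rightarrow> ('h \<Rightarrow>\<^sub>L 'h)) set" where
  "H2_ball = {f \<in> extensional nc_ball. free_holomorphic f \<and>
                (\<lambda>\<alpha>. (cmod (free_coeff f \<alpha>))\<^sup>2) summable_on UNIV}"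

definition H2_inner ::
  "(('h::complex_hilbert \<Rightarrow>\<^sub>L 'h) ^ 'n::finite \<Rightarrow> ('h \<Rightarrow>\<^sub>L 'h)) \<Rightarrow>
   (('h \<Rightarrow>\<^sub>L 'h) ^ 'n \<Rightarrow> ('h \<Rightarrow>\<^sub>L 'h)) \<Rightarrow> complex" where
  "H2_inner f g = (\<Sum>\<^sub>\<infinity>\<alpha>. free_coeff f \<alpha> * cnj (free_coeff g \<alpha>))"

definition H2_norm ::
  "(('h::complex_hilbert \<Rightarrow>\<^sub>L 'h) ^ 'n::finite \<Rightarrow> ('h \<Rightarrow>\<^sub>L 'h)) \<Rightarrow> real" where
  "H2_norm f = sqrt (\<Sum>\<^sub>\<infinity>\<alpha>. (cmod (free_coeff f \<alpha>))\<^sup>2)"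

type_synonym ('h, 'n) H2_op =
  "(('h \<Rightarrow>\<^sub>L 'h) ^ 'n \<Rightarrow> ('h \<Rightarrow>\<^sub>L 'h)) \<Rightarrow> (('h \<Rightarrow>\<^sub>L 'h) ^ 'n \<Rightarrow> ('h \<Rightarrow>\<^sub>L 'h))"

definition H2_bounded_op :: "('h::complex_hilbert, 'n::finite) H2_op \<Rightarrow> bool" where
  "H2_bounded_op T \<longleftrightarrow>
     (\<forall>f\<in>H2_ball. T f \<in> H2_ball) \<and>
     (\<forall>f\<in>H2_ball. \<forall>g\<in>H2_ball.
        T (\<lambda>X\<in>nc_ball. f X + g X) = (\<lambda>X\<in>nc_ball. T f X + T g X)) \<and>
     (\<forall>c. \<forall>f\<in>H2_ball.
        T (\<lambda>X\<in>nc_ball. cscale c (f X)) = (\<lambda>X\<in>nc_ball. cscale c (T f X))) \<and>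
     (\<exists>K. \<forall>f\<in>H2_ball. H2_norm (T f) \<le> K * H2_norm f)"

definition H2_is_adjoint ::
  "('h::complex_hilbert, 'n::finite) H2_op \<Rightarrow> ('h, 'n) H2_op \<Rightarrow> bool" where
  "H2_is_adjoint T S \<longleftrightarrow> H2_bounded_op S \<and>
     (\<forall>f\<in>H2_ball. \<forall>g\<in>H2_ball. H2_inner (T f) g = H2_inner f (S g))"

definition H2_normal :: "('h::complex_hilbert, 'n::finite) H2_op \<Rightarrow> bool" where
  "H2_normal T \<longleftrightarrow> H2_bounded_op T \<and>
     (\<exists>S. H2_is_adjoint T S \<and> (\<forall>f\<in>H2_ball. S (T f) = T (S f)))"

text \<open>Composition $f\circ\varphi=\sum_k\sum_{|\alpha|=k}a_\alpha\varphi_\alpha$, as a function on the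
  ball; note that $\varphi_\alpha(X)$ is \<open>word_prod (\<phi> X) \<alpha>\<close>.\<close>

definition comp_op ::
  "(('h::complex_hilbert \<Rightarrow>\<^sub>L 'h) ^ 'n::finite \<Rightarrow> ('h \<Rightarrow>\<^sub>L 'h) ^ 'n) \<Rightarrow> ('h, 'n) H2_op" where
  "comp_op \<phi> f =
     (\<lambda>X\<in>nc_ball. \<Sum>k. \<Sum>\<alpha> | length \<alpha> = k. cscale (free_coeff f \<alpha>) (word_prod (\<phi> X) \<alpha>))"


section \<open>Scalar matrices\<close>

definition conj_transpose :: "complex ^ 'n ^ 'm \<Rightarrow> complex ^ 'm ^ 'n" where
  "conj_transpose A = map_matrix cnj (transpose A)"

definition normal_matrix :: "complex ^ 'n ^ 'n::finite \<Rightarrow> bool" where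
  "normal_matrix A \<longleftrightarrow> conj_transpose A ** A = A ** conj_transpose A"

text \<open>\<open>tuple_mult X A\<close> is the row tuple $[X_1,\ldots,X_n]A$.\<close>

definition tuple_mult ::
  "('h::complex_hilbert \<Rightarrow>\<^sub>L 'h) ^ 'n::finite \<Rightarrow> complex ^ 'n ^ 'n \<Rightarrow> ('h \<Rightarrow>\<^sub>L 'h) ^ 'n" where
  "tuple_mult X A = (\<chi> j. \<Sum>i\<in>UNIV. cscale (A $ i $ j) (X $ i))"

end

theory Submission
  imports Defs
begin

text \<open>
  A free holomorphic function is determined by its coefficients, and the row contraction
  \<open>X\<close> satisfies $\|\sum_{|\alpha|=k} c_\alpha X_\alpha\| \le \|X\|^k (\sum_{|\alpha|=k} |c_\alpha|^2)^{1/2}$,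
  so $H^2_{\bf ball}$ is $\ell^2$ over the words. If $\varphi(X) = XA$, then $C_\varphi$ acts on the
  coefficients of degree $k$ as $A^{\otimes k}$, whose adjoint is $(A^*)^{\otimes k}$.

  Conversely, let $C_\varphi$ be normal, so that $\|C_\varphi f\| = \|C_\varphi^* f\|$. For $f = 1$
  this gives $C_\varphi^* 1 = 1$, that is, $\varphi(0) = 0$. Then $\varphi_\alpha$ has no terms of degree
  below $|\alpha|$, so $C_\varphi^* X_i$ is linear, and
  $\sum_i \|\varphi_i\|^2 = \sum_i \|C_\varphi^* X_i\|^2$ only involves the linear coefficients of the
  $\varphi_j$. Hence all other coefficients of each $\varphi_i$ vanish. Normality of $A$ is normality of
  $C_\varphi$ on the linear functions, and evaluation at scalar tuples bounds $\|A\|$.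
\<close>

subsection \<open>Operators on complex Hilbert spaces\<close>

lemma scaleC_one [simp]: "scaleC 1 (x::'h::complex_inner) = x"
  using scaleC_of_real[of 1 x] by simp

lemma scaleC_zero_left [simp]: "scaleC 0 (x::'h::complex_inner) = 0"
  using scaleC_of_real[of 0 x] by simp

lemma scaleC_zero_right [simp]: "scaleC c (0::'h::complex_inner) = 0"
  using norm_scaleC[of c "0::'h"] by simp

lemma module_scaleC: "module (scaleC :: complex \<Rightarrow> 'h::complex_inner \<Rightarrow> 'h)"
  by unfold_locales
    (simp_all add: scaleC_add_right scaleC_add_left scaleC_scaleC)

lemma bounded_linear_cinner_left: "bounded_linear (\<lambda>x::'h::complex_inner. cinner x y)"
proof -
  \<comment> \<open>As Re (i z) = - Im z, both parts of \<open>cinner\<close> are real inner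
    products; the real Cauchy-Schwarz inequality is used once for each, whence the factor 2.\<close>
  have eq: "cinner x y = Complex (inner x y) (- inner (scaleC \<i> x) y)" for x :: 'h
    by (simp add: complex_eq_iff inner_eq_Re_cinner cinner_scaleC_left)
  have "cmod (cinner x y) \<le> norm x * (2 * norm y)" for x
  proof -
    have "cmod (cinner x y) \<le> \<bar>inner x y\<bar> + \<bar>inner (scaleC \<i> x) y\<bar>"
      using cmod_le[of "cinner x y"] eq[of x] by simp
    also have "\<dots> \<le> norm x * norm y + norm (scaleC \<i> x) * norm y"
      by (intro add_mono Cauchy_Schwarz_ineq2)
    finally show ?thesis by (simp add: norm_scaleC)
  qed
  then show ?thesis
    by (intro bounded_linear_intro[where K = "2 * norm y"])
      (simp_all add: cinner_add_left scaleC_of_real[symmetric] cinner_scaleC_left scaleR_conv_of_real)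
qed

lemmas cinner_simps =
  bounded_linear.linear[OF bounded_linear_cinner_left, THEN linear_0]
  bounded_linear.linear[OF bounded_linear_cinner_left, THEN linear_diff]
  bounded_linear.linear[OF bounded_linear_cinner_left, THEN linear_sum]

lemma cinner_zero_left [simp]: "cinner 0 (y::'h::complex_inner) = 0"
  by (rule cinner_simps)

lemma cinner_scaleC_right: "cinner (x::'h::complex_inner) (scaleC c y) = cnj c * cinner x y"
  using cinner_commute[of x "scaleC c y"] cinner_commute[of x y] by (simp add: cinner_scaleC_left)

lemma cinner_self: "cinner x x = complex_of_real ((norm (x::'h::complex_inner))\<^sup>2)"
proof -
  have "Im (cinner x x) = 0"
    using cinner_commute[of x x] by (simp add: complex_eq_iff)
  then show ?thesis
    by (simp add: complex_eq_iff inner_eq_Re_cinner[symmetric] power2_norm_eq_inner)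
qed

text \<open>Variational proof: the representing vector minimizes
  \<open>J x = (norm x)^2 - 2 * f x\<close>. The parallelogram law makes a minimizing sequence
  Cauchy, and the first variation at its limit vanishes.\<close>

lemma riesz_representation:
  fixes f :: "'a::{real_inner, complete_space} \<Rightarrow> real"
  assumes f: "bounded_linear f"
  shows "\<exists>y. \<forall>x. f x = inner x y"
proof -
  interpret f: bounded_linear f by fact
  define J where "J x = (norm x)\<^sup>2 - 2 * f x" for x
  obtain K where K: "\<And>x. \<bar>f x\<bar> \<le> norm x * K"
    using f.bounded by (auto simp: mult.commute)
  have J_ge: "J x \<ge> - K\<^sup>2" for x
  proof -
    have "0 \<le> (norm x - K)\<^sup>2" by simp
    then show ?thesis using K[of x] unfolding J_def power2_diff by (simp add: abs_le_iff)
  qed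
  define m where "m = Inf (range J)"
  have bdd: "bdd_below (range J)" using J_ge by (auto intro!: bdd_belowI)
  have m_le: "m \<le> J x" for x unfolding m_def by (intro cInf_lower bdd) auto
  have "\<exists>x. J x < m + 1 / real (Suc n)" for n
    using cInf_lessD[of "range J" "m + 1 / real (Suc n)"] unfolding m_def by auto
  then obtain s where s: "\<And>n. J (s n) < m + 1 / real (Suc n)" by metis
  \<comment> \<open>Parallelogram law; the contributions of \<open>f\<close> cancel because
    \<open>f\<close> is additive at the midpoint.\<close>
  have par: "(norm (x - y))\<^sup>2 = 2 * J x + 2 * J y - 4 * J ((1/2) *\<^sub>R (x + y))" for x y
    by (simp add: J_def power2_norm_eq_inner f.add f.scaleR inner_add inner_diff algebra_simps inner_commute)
  have dist_le: "(norm (s p - s q))\<^sup>2 \<le> 4 / real (Suc N)" if "p \<ge> N" "q \<ge> N" for p q N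
  proof -
    have "1 / real (Suc p) \<le> 1 / real (Suc N)" "1 / real (Suc q) \<le> 1 / real (Suc N)"
      using that by (auto intro!: divide_left_mono)
    then show ?thesis
      using par[of "s p" "s q"] s[of p] s[of q] m_le[of "(1/2) *\<^sub>R (s p + s q)"] by simp
  qed
  have "Cauchy s"
  proof (rule metric_CauchyI)
    fix e :: real assume e: "e > 0"
    obtain N where N: "inverse (real (Suc N)) < e\<^sup>2 / 4"
      using reals_Archimedean[of "e\<^sup>2 / 4"] e by auto
    have "dist (s p) (s q) < e" if "p \<ge> N" "q \<ge> N" for p q
    proof -
      have "(norm (s p - s q))\<^sup>2 < e\<^sup>2"
        using dist_le[OF that] N by (simp del: of_nat_Suc add: inverse_eq_divide)
      then have "norm (s p - s q) < e" using e by (rule power2_less_imp_less[OF _ less_imp_le])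
      then show ?thesis by (simp only: dist_norm)
    qed
    then show "\<exists>N. \<forall>p\<ge>N. \<forall>q\<ge>N. dist (s p) (s q) < e" by blast
  qed
  then obtain y where y: "s \<longlonglongrightarrow> y" using Cauchy_convergent convergent_def by blast
  have "(\<lambda>n. J (s n)) \<longlonglongrightarrow> J y"
    unfolding J_def by (intro tendsto_intros y f.tendsto)
  moreover have "(\<lambda>n. m + 1 / real (Suc n)) \<longlonglongrightarrow> m + 0"
    by (intro tendsto_intros LIMSEQ_Suc lim_1_over_n)
  ultimately have Jy: "J y \<le> m"
    using s by (intro LIMSEQ_le[of "\<lambda>n. J (s n)" "J y" "\<lambda>n. m + 1 / real (Suc n)" m]) (auto intro: less_imp_le)
  have "f x = inner x y" for x
  proof (rule ccontr)
    assume ne: "f x \<noteq> inner x y"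
    define d where "d = f x - inner x y"
    \<comment> \<open>Comparison of \<open>J\<close> at \<open>y\<close> and at
      \<open>y + t x\<close>. The choice of \<open>t\<close> below minimizes this quadratic and
      makes it negative unless \<open>d = 0\<close>.\<close>
    have *: "0 \<le> t\<^sup>2 * (norm x)\<^sup>2 - 2 * t * d" for t
    proof -
      have "J y \<le> J (y + t *\<^sub>R x)" using Jy m_le order_trans by blast
      then show ?thesis
        unfolding J_def d_def power2_norm_eq_inner
        by (simp add: f.add f.scaleR inner_add algebra_simps inner_commute power2_eq_square)
    qed
    have "x \<noteq> 0" using ne f.zero by auto
    then have nx: "norm x > 0" by simp
    have "0 \<le> - (d\<^sup>2 / (norm x)\<^sup>2)"
      using *[of "d / (norm x)\<^sup>2"] nx by (simp add: power2_eq_square)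
    moreover have "d \<noteq> 0" using ne by (simp add: d_def)
    ultimately show False using nx by (simp add: divide_le_0_iff not_le)
  qed
  then show ?thesis by blast
qed

section \<open>Existence and uniqueness of adjoints\<close>

lemma inner_right_eqI:
  fixes y z :: "'a::real_inner"
  assumes "\<And>x. inner x y = inner x z"
  shows "y = z"
  using assms[of "y - z"] by (metis eq_iff_diff_eq_0 inner_diff_right inner_eq_zero_iff)

text \<open>Riesz gives the adjoint for the real inner product, hence equality of real parts.
  Applying this to i x, through which the complex-linear \<open>T\<close> passes, gives the
  imaginary parts.\<close>

lemma op_adjoint_exists:
  fixes T :: "'h::complex_hilbert \<Rightarrow>\<^sub>L 'h"
  assumes T: "T \<in> cblinops"
  shows "\<exists>S. \<forall>x y. cinner (T x) y = cinner x (blinfun_apply S y)"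
proof -
  have "\<exists>z. \<forall>x. inner (T x) y = inner x z" for y
    by (intro riesz_representation bounded_linear_compose[OF bounded_linear_inner_left] blinfun.bounded_linear_right)
  then obtain s where s: "\<And>x y. inner (T x) y = inner x (s y)" by metis
  have "bounded_linear s"
  proof (rule bounded_linear_intro[where K = "norm T"])
    fix y z :: 'h and r :: real
    have "inner x (s (y + z)) = inner x (s y + s z)" for x
      by (simp add: s[symmetric] inner_add_right)
    then show "s (y + z) = s y + s z" by (rule inner_right_eqI)
    have "inner x (s (r *\<^sub>R y)) = inner x (r *\<^sub>R s y)" for x
      by (simp add: s[symmetric])
    then show "s (r *\<^sub>R y) = r *\<^sub>R s y" by (rule inner_right_eqI)
    have "norm (s y) * norm (s y) = inner (T (s y)) y"
      by (simp add: s power2_norm_eq_inner[symmetric] power2_eq_square)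
    also have "\<dots> \<le> norm T * norm (s y) * norm y"
      by (rule order_trans[OF norm_cauchy_schwarz]) (intro mult_right_mono norm_blinfun norm_ge_zero)
    finally show "norm (s y) \<le> norm y * norm T"
      by (cases "s y = 0") (auto simp: mult_ac)
  qed
  then have S: "blinfun_apply (Blinfun s) y = s y" for y
    by (simp add: bounded_linear_Blinfun_apply)
  have "cinner (T x) y = cinner x (blinfun_apply (Blinfun s) y)" for x y
  proof (rule complex_eqI)
    show "Re (cinner (T x) y) = Re (cinner x (blinfun_apply (Blinfun s) y))"
      by (simp add: inner_eq_Re_cinner[symmetric] s S)
    have "Re (cinner (T (scaleC \<i> x)) y) = Re (cinner (scaleC \<i> x) (s y))"
      by (simp add: inner_eq_Re_cinner[symmetric] s)
    then show "Im (cinner (T x) y) = Im (cinner x (blinfun_apply (Blinfun s) y))"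
      using T by (simp add: cblinops_def cinner_scaleC_left S)
  qed
  then show ?thesis by blast
qed

lemma op_adjoint_eqI:
  fixes T :: "'h::complex_hilbert \<Rightarrow>\<^sub>L 'h"
  assumes "\<And>x y. cinner (T x) y = cinner x (blinfun_apply S y)"
  shows "op_adjoint T = S"
  unfolding op_adjoint_def
proof (rule the_equality)
  fix S' assume S': "\<forall>x y. cinner (T x) y = cinner x (blinfun_apply S' y)"
  show "S' = S"
  proof (rule blinfun_eqI)
    fix y
    have "inner x (blinfun_apply S' y) = inner x (blinfun_apply S y)" for x
      using S' assms by (simp add: inner_eq_Re_cinner)
    then show "blinfun_apply S' y = blinfun_apply S y" by (rule inner_right_eqI)
  qed
qed (use assms in blast)

lemma cinner_op_adjoint:
  fixes T :: "'h::complex_hilbert \<Rightarrow>\<^sub>L 'h"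
  assumes "T \<in> cblinops"
  shows "cinner (T x) y = cinner x (op_adjoint T y)"
  using op_adjoint_exists[OF assms] op_adjoint_eqI by metis

lemma op_adjoint_scaleR:
  fixes T :: "'h::complex_hilbert \<Rightarrow>\<^sub>L 'h"
  assumes "T \<in> cblinops"
  shows "op_adjoint (r *\<^sub>R T) = r *\<^sub>R op_adjoint T"
  by (rule op_adjoint_eqI)
    (simp add: blinfun.scaleR_left scaleC_of_real[symmetric] cinner_scaleC_left cinner_scaleC_right
      cinner_op_adjoint[OF assms])

section \<open>The algebra of complex-linear operators and the noncommutative ball\<close>

lemma cblinops_scaleR: "T \<in> cblinops \<Longrightarrow> r *\<^sub>R T \<in> cblinops"
  by (simp add: cblinops_def blinfun.scaleR_left scaleC_of_real[symmetric] scaleC_scaleC mult.commute)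

lemma cblinops_zero: "0 \<in> cblinops"
  using cblinops_scaleR[of id_blinfun 0] by (simp add: cblinops_def)

lemma cblinops_add: "S \<in> cblinops \<Longrightarrow> T \<in> cblinops \<Longrightarrow> S + T \<in> cblinops"
  by (simp add: cblinops_def blinfun.add_left scaleC_add_right)

lemma cblinops_sum: "(\<And>i. i \<in> I \<Longrightarrow> f i \<in> cblinops) \<Longrightarrow> sum f I \<in> cblinops"
  by (induction I rule: infinite_finite_induct) (auto intro: cblinops_zero cblinops_add)

text \<open>Lets test tuples be built without tracking their norms: what matters for them is which
  products vanish, and a positive scaling preserves that.\<close>

lemma scaled_in_nc_ball:
  fixes Y :: "('h::complex_hilbert \<Rightarrow>\<^sub>L 'h) ^ 'n::finite"
  assumes Y: "\<And>j. Y $ j \<in> cblinops"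
  shows "\<exists>r>0. (\<chi> j. r *\<^sub>R Y $ j) \<in> nc_ball"
proof -
  define M where "M = norm (\<Sum>i\<in>UNIV. Y $ i o\<^sub>L op_adjoint (Y $ i))"
  \<comment> \<open>The scaling multiplies the norm \<open>M\<close> by \<open>r * r\<close>; this
    choice gives both \<open>r * M < 1\<close> and \<open>r \<le> 1\<close>, also when
    \<open>M = 0\<close>.\<close>
  define r where "r = 1 / (M + 1)"
  have M: "M \<ge> 0" by (simp add: M_def)
  then have r: "r > 0" "r * M < 1" "r \<le> 1" by (auto simp: r_def field_simps)
  have "(\<Sum>i\<in>UNIV. (r *\<^sub>R Y $ i) o\<^sub>L op_adjoint (r *\<^sub>R Y $ i)) =
    (r * r) *\<^sub>R (\<Sum>i\<in>UNIV. Y $ i o\<^sub>L op_adjoint (Y $ i))"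
    unfolding scaleR_sum_right
    by (intro sum.cong refl blinfun_eqI)
      (simp add: op_adjoint_scaleR Y blinfun.scaleR_left blinfun.scaleR_right)
  then have "norm (\<Sum>i\<in>UNIV. (r *\<^sub>R Y $ i) o\<^sub>L op_adjoint (r *\<^sub>R Y $ i)) = r * (r * M)"
    by (simp add: M_def)
  moreover have "r * (r * M) \<le> 1 * (r * M)"
    using r M by (intro mult_right_mono) auto
  then have "r * (r * M) < 1" using r by linarith
  ultimately show ?thesis
    using r Y by (intro exI[of _ r]) (auto simp: nc_ball_def cblinops_scaleR)
qed

text \<open>A row operator and its adjoint have the same norm. With \<open>s = norm D\<close>, the
  quadratic form of \<open>D\<close> controls the adjoints of the entries, and Cauchy-Schwarz over
  the index set moves this bound to the row.\<close>

lemma nc_ball_row_bound: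
  fixes X :: "('h::complex_hilbert \<Rightarrow>\<^sub>L 'h) ^ 'n::finite"
  assumes X: "X \<in> nc_ball"
  obtains s where "0 \<le> s" "s < 1"
    "\<And>h. (norm (\<Sum>i\<in>UNIV. blinfun_apply (X $ i) (h i)))\<^sup>2 \<le> s * (\<Sum>i\<in>UNIV. (norm (h i))\<^sup>2)"
proof
  define D where "D = (\<Sum>i\<in>UNIV. X $ i o\<^sub>L op_adjoint (X $ i))"
  have Xc: "X $ i \<in> cblinops" for i using X by (simp add: nc_ball_def)
  show "0 \<le> norm D" "norm D < 1" using X by (simp_all add: nc_ball_def D_def)
  fix h :: "'n \<Rightarrow> 'h"
  define y where "y = (\<Sum>i\<in>UNIV. blinfun_apply (X $ i) (h i))"
  have adj: "inner ((X $ i) x) z = inner x (blinfun_apply (op_adjoint (X $ i)) z)" for i x z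
    by (simp add: inner_eq_Re_cinner cinner_op_adjoint[OF Xc])
  have "(\<Sum>i\<in>UNIV. (norm (blinfun_apply (op_adjoint (X $ i)) y))\<^sup>2) = inner (D y) y"
    by (simp add: D_def power2_norm_eq_inner adj[symmetric] blinfun.sum_left inner_sum_left inner_sum_right inner_commute)
  also have "\<dots> \<le> norm D * norm y * norm y"
    by (rule order_trans[OF norm_cauchy_schwarz]) (intro mult_right_mono norm_blinfun norm_ge_zero)
  finally have a: "(\<Sum>i\<in>UNIV. (norm (blinfun_apply (op_adjoint (X $ i)) y))\<^sup>2) \<le> norm D * (norm y)\<^sup>2"
    by (simp add: power2_eq_square mult_ac)
  define H where "H = (\<Sum>i\<in>UNIV. (norm (h i))\<^sup>2)"
  have "(norm y)\<^sup>2 = inner y y" by (simp add: power2_norm_eq_inner)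
  also have "\<dots> = (\<Sum>i\<in>UNIV. inner (h i) (blinfun_apply (op_adjoint (X $ i)) y))"
    by (subst (1) y_def) (simp add: inner_sum_left adj)
  also have "\<dots> \<le> (\<Sum>i\<in>UNIV. norm (h i) * norm (blinfun_apply (op_adjoint (X $ i)) y))"
    by (intro sum_mono norm_cauchy_schwarz)
  finally have "((norm y)\<^sup>2)\<^sup>2 \<le> (\<Sum>i\<in>UNIV. norm (h i) * norm (blinfun_apply (op_adjoint (X $ i)) y))\<^sup>2"
    by (intro power_mono) auto
  also have "\<dots> \<le> H * (\<Sum>i\<in>UNIV. (norm (blinfun_apply (op_adjoint (X $ i)) y))\<^sup>2)"
    unfolding H_def by (rule Cauchy_Schwarz_ineq_sum)
  also have "\<dots> \<le> H * (norm D * (norm y)\<^sup>2)"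
    by (intro mult_left_mono a) (simp add: H_def sum_nonneg)
  finally have "(norm y)\<^sup>2 * (norm y)\<^sup>2 \<le> (norm D * H) * (norm y)\<^sup>2"
    \<comment> \<open>The factor \<open>(norm y)^2\<close> now occurs on both sides and is
      cancelled, the case \<open>y = 0\<close> being trivial.\<close>
    by (simp add: power2_eq_square mult_ac)
  then have "(norm y)\<^sup>2 \<le> norm D * H"
    using mult_right_le_imp_le[of "(norm y)\<^sup>2" "(norm y)\<^sup>2" "norm D * H"]
    by (cases "y = 0") (simp_all add: H_def sum_nonneg)
  then show "(norm (\<Sum>i\<in>UNIV. blinfun_apply (X $ i) (h i)))\<^sup>2 \<le> norm D * (\<Sum>i\<in>UNIV. (norm (h i))\<^sup>2)"
    by (simp add: y_def H_def)
qed

text \<open>Gram-Schmidt: since no finite set spans, there is always a vector outside the span of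
  those found so far.\<close>

lemma orthonormal_exists:
  assumes infinite_dim: "\<forall>B :: 'h::complex_hilbert set. finite B \<longrightarrow> module.span scaleC B \<noteq> UNIV"
  shows "\<exists>e :: nat \<Rightarrow> 'h. \<forall>p<k. \<forall>q<k. cinner (e p) (e q) = of_bool (p = q)"
proof (induction k)
  case (Suc k)
  interpret C: module "scaleC :: complex \<Rightarrow> 'h \<Rightarrow> 'h" by (rule module_scaleC)
  obtain e :: "nat \<Rightarrow> 'h" where e: "\<And>p q. p < k \<Longrightarrow> q < k \<Longrightarrow> cinner (e p) (e q) = of_bool (p = q)"
    using Suc by blast
  obtain x where x: "x \<notin> C.span (e ` {..<k})"
    using infinite_dim[rule_format, of "e ` {..<k}"] by auto
  define y where "y = x - (\<Sum>p<k. scaleC (cinner x (e p)) (e p))"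
  have "y \<noteq> 0"
    using x C.span_sum[of "{..<k}" "\<lambda>p. scaleC (cinner x (e p)) (e p)" "e ` {..<k}"]
      C.span_scale C.span_base unfolding y_def by (metis (no_types, lifting) eq_iff_diff_eq_0 imageI)
  define z where "z = scaleC (complex_of_real (1 / norm y)) y"
  have yq: "cinner y (e q) = 0" if "q < k" for q
    using that by (simp add: y_def cinner_simps cinner_scaleC_left e of_bool_def if_distrib sum.delta cong: if_cong)
  then have zq: "cinner z (e q) = 0" "cinner (e q) z = 0" if "q < k" for q
    using that cinner_commute[of "e q" z] by (simp_all add: z_def cinner_scaleC_left)
  have "cinner z z = 1"
    using \<open>y \<noteq> 0\<close> unfolding cinner_self by (simp add: z_def norm_scaleC norm_divide)
  with zq e have "\<forall>p<Suc k. \<forall>q<Suc k. cinner ((e(k := z)) p) ((e(k := z)) q) = of_bool (p = q)"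
    by (auto simp: less_Suc_eq)
  then show ?case by blast
qed simp

lift_definition rank_one :: "'h::complex_inner \<Rightarrow> 'h \<Rightarrow> 'h \<Rightarrow>\<^sub>L 'h" is
  "\<lambda>u v x. scaleC (cinner x v) u"
proof -
  fix u v :: 'h
  interpret L: bounded_linear "\<lambda>x. cinner x v" by (rule bounded_linear_cinner_left)
  obtain K where "\<And>x. cmod (cinner x v) \<le> norm x * K" using L.bounded by blast
  then have "norm (scaleC (cinner x v) u) \<le> norm x * (K * norm u)" for x
    by (simp add: norm_scaleC mult.assoc[symmetric] mult_right_mono)
  then show "bounded_linear (\<lambda>x. scaleC (cinner x v) u)"
    by (intro bounded_linear_intro[where K = "K * norm u"])
      (simp_all add: cinner_add_left scaleC_add_left scaleC_of_real[symmetric] cinner_scaleC_left scaleC_scaleC)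
qed

lemma rank_one_cblinops: "rank_one u v \<in> cblinops"
  by (simp add: cblinops_def rank_one.rep_eq cinner_scaleC_left scaleC_scaleC)

subsection \<open>Square-summable coefficients and second quantization\<close>

text \<open>Makes the space of operators a Banach space, so that norm-dominated series of operators
  converge.\<close>

instance complex_hilbert \<subseteq> banach ..

section \<open>Finite sums over words of a given length\<close>

lemma finite_words [simp]: "finite {\<alpha> :: 'n::finite list. length \<alpha> = k}"
  using finite_lists_length_eq[of "UNIV :: 'n set" k] by simp

lemma finite_words_less [simp]: "finite {\<alpha> :: 'n::finite list. length \<alpha> < k}"
  by (rule finite_subset[OF _ finite_lists_length_le[of "UNIV :: 'n set" k]]) auto

lemma sum_words_0 [simp]: "(\<Sum>\<alpha> | length \<alpha> = 0. F \<alpha>) = F []"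
  by simp

text \<open>Splitting off the first letter is what drives the inductions on the degree
  below.\<close>

lemma sum_words_Suc:
  fixes F :: "'n::finite list \<Rightarrow> 'a::comm_monoid_add"
  shows "(\<Sum>\<alpha> | length \<alpha> = Suc k. F \<alpha>) = (\<Sum>i\<in>UNIV. \<Sum>\<alpha> | length \<alpha> = k. F (i # \<alpha>))"
proof -
  have "(\<Sum>i\<in>UNIV. \<Sum>\<alpha> | length \<alpha> = k. F (i # \<alpha>)) =
    (\<Sum>(i, \<alpha>)\<in>UNIV \<times> {\<alpha>. length \<alpha> = k}. F (i # \<alpha>))"
    by (rule sum.cartesian_product)
  also have "\<dots> = (\<Sum>\<alpha> | length \<alpha> = Suc k. F \<alpha>)"
    by (rule sum.reindex_bij_witness[of _ "\<lambda>\<alpha>. (hd \<alpha>, tl \<alpha>)" "\<lambda>(i, \<alpha>). i # \<alpha>"])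
      (auto simp: length_Suc_conv)
  finally show ?thesis by simp
qed

lemma sum_words_less_Suc:
  fixes F :: "'n::finite list \<Rightarrow> 'a::comm_monoid_add"
  shows "(\<Sum>\<alpha> | length \<alpha> < Suc k. F \<alpha>) = (\<Sum>\<alpha> | length \<alpha> < k. F \<alpha>) + (\<Sum>\<alpha> | length \<alpha> = k. F \<alpha>)"
proof -
  have "{\<alpha> :: 'n list. length \<alpha> < Suc k} = {\<alpha>. length \<alpha> < k} \<union> {\<alpha>. length \<alpha> = k}" by auto
  then show ?thesis by (simp add: sum.union_disjoint disjoint_iff)
qed

section \<open>Products along words and complex multiples of operators\<close>

lemma word_prod_Nil [simp]: "word_prod X [] = id_blinfun"
  by (simp add: word_prod_def)

lemma word_prod_Cons [simp]: "word_prod X (i # \<alpha>) = X $ i o\<^sub>L word_prod X \<alpha>"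
  by (simp add: word_prod_def)

lemma cscale_0 [simp]: "cscale 0 T = 0"
proof (rule blinfun_eqI)
  show "blinfun_apply (cscale 0 T) x = blinfun_apply 0 x" for x
    using scaleC_of_real[of 0 "blinfun_apply T x"] by (simp add: cscale.rep_eq)
qed

lemma cscale_1 [simp]: "cscale 1 T = T"
  by (rule blinfun_eqI) (simp add: cscale.rep_eq)

lemma cscale_cscale [simp]: "cscale c (cscale d T) = cscale (c * d) T"
  by (rule blinfun_eqI) (simp add: cscale.rep_eq scaleC_scaleC)

lemma cscale_add_left: "cscale (c + d) T = cscale c T + cscale d T"
  by (rule blinfun_eqI) (simp add: cscale.rep_eq scaleC_add_left blinfun.add_left)

lemma bounded_linear_cscale: "bounded_linear (cscale c)"
proof (rule bounded_linear_intro[where K = "cmod c"])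
  show "norm (cscale c T) \<le> norm T * cmod c" for T :: "'a \<Rightarrow>\<^sub>L 'a"
    by (rule norm_blinfun_bound)
      (simp_all add: cscale.rep_eq norm_scaleC mult_left_mono norm_blinfun mult.assoc mult.left_commute)
qed (auto intro!: blinfun_eqI simp: cscale.rep_eq scaleC_add_right blinfun.add_left blinfun.scaleR_left
  scaleC_of_real[symmetric] scaleC_scaleC mult.commute)

lemma cscale_sum_left: "cscale (sum f I) T = (\<Sum>i\<in>I. cscale (f i) T)"
  by (induction I rule: infinite_finite_induct) (auto simp: cscale_add_left)

lemma cscale_zero_right [simp]: "cscale c 0 = 0"
  by (rule linear_0[OF bounded_linear.linear[OF bounded_linear_cscale]])

lemmas cscale_sum_right = bounded_linear.linear[OF bounded_linear_cscale, THEN linear_sum]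

section \<open>Homogeneous parts and convergence of the series\<close>

definition hom_part ::
  "('n list \<Rightarrow> complex) \<Rightarrow> nat \<Rightarrow> ('h::complex_hilbert \<Rightarrow>\<^sub>L 'h) ^ 'n::finite \<Rightarrow> ('h \<Rightarrow>\<^sub>L 'h)" where
  "hom_part c k X = (\<Sum>\<alpha> | length \<alpha> = k. cscale (c \<alpha>) (word_prod X \<alpha>))"

definition l2 :: "('n list \<Rightarrow> complex) \<Rightarrow> bool" where
  "l2 c \<longleftrightarrow> (\<lambda>\<alpha>. (cmod (c \<alpha>))\<^sup>2) summable_on UNIV"

text \<open>Inverse of \<open>free_coeff\<close> on square-summable families. Restricting to the
  ball provides the extensionality that \<open>H2_ball\<close> demands.\<close>

definition of_coeff ::
  "('n list \<Rightarrow> complex) \<Rightarrow> ('h::complex_hilbert \<Rightarrow>\<^sub>L 'h) ^ 'n::finite \<Rightarrow> ('h \<Rightarrow>\<^sub>L 'h)" where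
  "of_coeff c = (\<lambda>X\<in>nc_ball. \<Sum>k. hom_part c k X)"

lemma hom_part_Suc:
  assumes "\<And>i. X $ i \<in> cblinops"
  shows "blinfun_apply (hom_part c (Suc k) X) h =
    (\<Sum>i\<in>UNIV. blinfun_apply (X $ i) (blinfun_apply (hom_part (\<lambda>\<alpha>. c (i # \<alpha>)) k X) h))"
  using assms
  by (simp add: hom_part_def sum_words_Suc blinfun.sum_left blinfun.sum_right cscale.rep_eq cblinops_def)

text \<open>Each letter factored out on the left costs one application of the row bound, hence one
  factor \<open>s\<close>. Treating all first letters at once avoids the growth with the number of
  words that the triangle inequality would bring.\<close>

lemma hom_part_bound:
  fixes X :: "('h::complex_hilbert \<Rightarrow>\<^sub>L 'h) ^ 'n::finite"
  assumes X: "\<And>i. X $ i \<in> cblinops" and s: "s \<ge> 0"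
    and row: "\<And>h. (norm (\<Sum>i\<in>UNIV. blinfun_apply (X $ i) (h i)))\<^sup>2 \<le> s * (\<Sum>i\<in>UNIV. (norm (h i))\<^sup>2)"
  shows "(norm (blinfun_apply (hom_part c k X) h))\<^sup>2 \<le>
    s ^ k * (\<Sum>\<alpha> | length \<alpha> = k. (cmod (c \<alpha>))\<^sup>2) * (norm h)\<^sup>2"
proof (induction k arbitrary: c)
  case 0
  show ?case by (simp add: hom_part_def cscale.rep_eq norm_scaleC power_mult_distrib)
next
  case (Suc k)
  have "(norm (blinfun_apply (hom_part c (Suc k) X) h))\<^sup>2 \<le>
    s * (\<Sum>i\<in>UNIV. (norm (blinfun_apply (hom_part (\<lambda>\<alpha>. c (i # \<alpha>)) k X) h))\<^sup>2)"
    unfolding hom_part_Suc[OF X] by (rule row)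
  also have "\<dots> \<le> s * (\<Sum>i\<in>UNIV. s ^ k * (\<Sum>\<alpha> | length \<alpha> = k. (cmod (c (i # \<alpha>)))\<^sup>2) * (norm h)\<^sup>2)"
    by (intro mult_left_mono sum_mono Suc s)
  also have "\<dots> = s ^ Suc k * (\<Sum>\<alpha> | length \<alpha> = Suc k. (cmod (c \<alpha>))\<^sup>2) * (norm h)\<^sup>2"
    by (simp add: sum_words_Suc sum_distrib_left sum_distrib_right mult_ac)
  finally show ?case .
qed

lemma l2_words_le:
  assumes "l2 c" "finite F"
  shows "(\<Sum>\<alpha>\<in>F. (cmod (c \<alpha>))\<^sup>2) \<le> (\<Sum>\<^sub>\<infinity>\<alpha>. (cmod (c \<alpha>))\<^sup>2)"
  using assms by (intro finite_sum_le_infsum) (auto simp: l2_def)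

lemma l2_limsup:
  fixes c :: "'n::finite list \<Rightarrow> complex"
  assumes c: "l2 c"
  shows "limsup (\<lambda>k. ereal (root (2 * k) (\<Sum>\<alpha> | length \<alpha> = k. (cmod (c \<alpha>))\<^sup>2))) \<le> 1"
proof -
  \<comment> \<open>The maximum with 1 keeps \<open>M\<close> positive, so that its roots tend to
    1.\<close>
  define M where "M = max 1 (\<Sum>\<^sub>\<infinity>\<alpha>. (cmod (c \<alpha>))\<^sup>2)"
  have "(\<lambda>k. root (2 * k) M) \<longlonglongrightarrow> 1"
    by (rule filterlim_compose[OF LIMSEQ_root_const])
      (auto simp: M_def intro!: filterlim_subseq strict_monoI)
  then have "limsup (\<lambda>k. ereal (root (2 * k) M)) = 1"
    by (intro lim_imp_Limsup) (auto simp: one_ereal_def)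
  moreover have "limsup (\<lambda>k. ereal (root (2 * k) (\<Sum>\<alpha> | length \<alpha> = k. (cmod (c \<alpha>))\<^sup>2)))
    \<le> limsup (\<lambda>k. ereal (root (2 * k) M))"
  proof (intro Limsup_mono eventually_mono[OF eventually_gt_at_top[of 0]])
    fix k :: nat assume "0 < k"
    then show "ereal (root (2 * k) (\<Sum>\<alpha> | length \<alpha> = k. (cmod (c \<alpha>))\<^sup>2)) \<le> ereal (root (2 * k) M)"
      using l2_words_le[OF c, of "{\<alpha>. length \<alpha> = k}"] by (simp add: M_def)
  qed
  ultimately show ?thesis by simp
qed

text \<open>Every degree carries at most the total square sum of \<open>c\<close>, so
  \<open>hom_part_bound\<close> gives a geometric majorant of ratio
  \<open>sqrt s < 1\<close>.\<close>

lemma summable_hom_part: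
  fixes X :: "('h::complex_hilbert \<Rightarrow>\<^sub>L 'h) ^ 'n::finite"
  assumes X: "X \<in> nc_ball" and c: "l2 c"
  shows "summable (\<lambda>k. hom_part c k X)"
proof -
  have Xc: "X $ i \<in> cblinops" for i using X by (simp add: nc_ball_def)
  obtain s where s: "0 \<le> s" "s < 1"
    "\<And>h. (norm (\<Sum>i\<in>UNIV. blinfun_apply (X $ i) (h i)))\<^sup>2 \<le> s * (\<Sum>i\<in>UNIV. (norm (h i))\<^sup>2)"
    using nc_ball_row_bound[OF X] by blast
  define M where "M = (\<Sum>\<^sub>\<infinity>\<alpha>. (cmod (c \<alpha>))\<^sup>2)"
  have M: "0 \<le> M" unfolding M_def by (intro infsum_nonneg) auto
  have "norm (hom_part c k X) \<le> sqrt s ^ k * sqrt M" for k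
  proof (rule norm_blinfun_bound)
    fix h
    have "(norm (blinfun_apply (hom_part c k X) h))\<^sup>2 \<le>
      s ^ k * (\<Sum>\<alpha> | length \<alpha> = k. (cmod (c \<alpha>))\<^sup>2) * (norm h)\<^sup>2"
      by (rule hom_part_bound[OF Xc s(1,3)])
    also have "\<dots> \<le> s ^ k * M * (norm h)\<^sup>2"
      unfolding M_def using s by (intro mult_right_mono mult_left_mono l2_words_le c) auto
    also have "\<dots> = (sqrt s ^ k * sqrt M * norm h)\<^sup>2"
    proof -
      have "(sqrt s ^ k)\<^sup>2 = (sqrt s * sqrt s) ^ k"
        by (simp only: power2_eq_square power_mult_distrib)
      then show ?thesis using s M by (simp add: power_mult_distrib)
    qed
    finally show "norm (blinfun_apply (hom_part c k X) h) \<le> sqrt s ^ k * sqrt M * norm h"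
      by (rule power2_le_imp_le) (use s M in auto)
  qed (use s M in auto)
  moreover have "summable (\<lambda>k. sqrt s ^ k * sqrt M)"
    using s by (intro summable_mult2 summable_geometric) simp_all
  ultimately show ?thesis
    by (intro summable_comparison_test[of "\<lambda>k. hom_part c k X"] exI[of _ 0]) auto
qed

lemma of_coeff_series:
  assumes "l2 c"
  shows "has_free_series (of_coeff c) c"
  using summable_hom_part[OF _ assms] l2_limsup[OF assms]
  unfolding has_free_series_def hom_part_def[symmetric]
  by (auto simp: of_coeff_def summable_sums)

lemma free_seriesD:
  assumes "has_free_series f a" "X \<in> nc_ball"
  shows "(\<lambda>k. hom_part a k X) sums f X"
  using assms unfolding has_free_series_def hom_part_def[symmetric] by blast

lemma of_coeff_unique:
  assumes "has_free_series f a" "f \<in> extensional nc_ball"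
  shows "f = of_coeff a"
  using assms free_seriesD[OF assms(1)]
  by (intro extensionalityI[of _ nc_ball]) (auto simp: of_coeff_def sums_iff)

text \<open>Every finite set of words has bounded length, so bounds on the truncations by degree
  suffice.\<close>

lemma l2_bound:
  fixes c :: "'n::finite list \<Rightarrow> complex"
  assumes le: "\<And>N. (\<Sum>\<alpha> | length \<alpha> < N. (cmod (c \<alpha>))\<^sup>2) \<le> M"
  shows "l2 c" "(\<Sum>\<^sub>\<infinity>\<alpha>. (cmod (c \<alpha>))\<^sup>2) \<le> M"
proof -
  have F: "(\<Sum>\<alpha>\<in>F. (cmod (c \<alpha>))\<^sup>2) \<le> M" if "finite F" for F
  proof -
    have "F \<subseteq> {\<alpha>. length \<alpha> < Suc (Max (length ` F))}"
      using that by (auto simp: less_Suc_eq_le)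
    then have "(\<Sum>\<alpha>\<in>F. (cmod (c \<alpha>))\<^sup>2) \<le> (\<Sum>\<alpha> | length \<alpha> < Suc (Max (length ` F)). (cmod (c \<alpha>))\<^sup>2)"
      by (intro sum_mono2) auto
    then show ?thesis using le order_trans by blast
  qed
  show "l2 c"
    unfolding l2_def using F by (intro nonneg_bdd_above_summable_on bdd_aboveI2) auto
  then show "(\<Sum>\<^sub>\<infinity>\<alpha>. (cmod (c \<alpha>))\<^sup>2) \<le> M"
    unfolding l2_def using F by (intro infsum_le_finite_sums) auto
qed

text \<open>The truncations by length are cofinal among the finite sets of words. Identities between
  unordered sums can therefore be checked degree by degree.\<close>

lemma infsum_words_lim:
  fixes f :: "'n::finite list \<Rightarrow> 'a::{comm_monoid_add, t2_space}"
  assumes "f summable_on UNIV"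
  shows "(\<lambda>N. \<Sum>\<alpha> | length \<alpha> < N. f \<alpha>) \<longlonglongrightarrow> infsum f UNIV"
proof -
  have "filterlim (\<lambda>N. {\<alpha> :: 'n list. length \<alpha> < N}) (finite_subsets_at_top UNIV) sequentially"
    unfolding filterlim_finite_subsets_at_top
  proof (intro allI impI)
    fix F :: "'n list set" assume F: "finite F \<and> F \<subseteq> UNIV"
    show "\<forall>\<^sub>F N in sequentially. finite {\<alpha> :: 'n list. length \<alpha> < N} \<and>
        F \<subseteq> {\<alpha>. length \<alpha> < N} \<and> {\<alpha> :: 'n list. length \<alpha> < N} \<subseteq> UNIV"
    proof (rule eventually_sequentiallyI[of "Suc (Max (length ` F))"])
      fix N assume "Suc (Max (length ` F)) \<le> N"
      moreover have "length \<alpha> \<le> Max (length ` F)" if "\<alpha> \<in> F" for \<alpha>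
        using F that by simp
      ultimately show "finite {\<alpha> :: 'n list. length \<alpha> < N} \<and>
          F \<subseteq> {\<alpha>. length \<alpha> < N} \<and> {\<alpha> :: 'n list. length \<alpha> < N} \<subseteq> UNIV"
        by fastforce
    qed
  qed
  with infsum_tendsto[OF assms] show ?thesis by (rule filterlim_compose)
qed

section \<open>Degreewise comparison, and the linear structure of square-summable families\<close>

lemma sum_words_less_mono:
  fixes F G :: "'n::finite list \<Rightarrow> real"
  assumes "\<And>k. (\<Sum>\<alpha> | length \<alpha> = k. F \<alpha>) \<le> (\<Sum>\<alpha> | length \<alpha> = k. G \<alpha>)"
  shows "(\<Sum>\<alpha> | length \<alpha> < N. F \<alpha>) \<le> (\<Sum>\<alpha> | length \<alpha> < N. G \<alpha>)"
  by (induction N) (simp_all add: sum_words_less_Suc add_mono assms)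

lemma sum_words_less_cong:
  fixes F G :: "'n::finite list \<Rightarrow> 'a::comm_monoid_add"
  assumes "\<And>k. (\<Sum>\<alpha> | length \<alpha> = k. F \<alpha>) = (\<Sum>\<alpha> | length \<alpha> = k. G \<alpha>)"
  shows "(\<Sum>\<alpha> | length \<alpha> < N. F \<alpha>) = (\<Sum>\<alpha> | length \<alpha> < N. G \<alpha>)"
  by (induction N) (simp_all add: sum_words_less_Suc assms)

lemma l2_inner_summable:
  assumes "l2 c" "l2 d"
  shows "(\<lambda>\<alpha>. c \<alpha> * cnj (d \<alpha>)) summable_on UNIV"
proof -
  have "(\<lambda>\<alpha>. norm (c \<alpha> * cnj (d \<alpha>))) summable_on UNIV"
  proof (rule summable_on_comparison_test)
    show "(\<lambda>\<alpha>. (cmod (c \<alpha>))\<^sup>2 + (cmod (d \<alpha>))\<^sup>2) summable_on UNIV"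
      by (rule summable_on_add[OF assms[unfolded l2_def]])
    fix \<alpha>
    have "0 \<le> (cmod (c \<alpha>) - cmod (d \<alpha>))\<^sup>2" "0 \<le> cmod (c \<alpha>) * cmod (d \<alpha>)" by simp_all
    then show "norm (c \<alpha> * cnj (d \<alpha>)) \<le> (cmod (c \<alpha>))\<^sup>2 + (cmod (d \<alpha>))\<^sup>2"
      unfolding norm_mult complex_mod_cnj power2_diff by linarith
  qed simp
  then show ?thesis by (rule abs_summable_summable)
qed

lemma infsum_finite_support:
  fixes f :: "'a \<Rightarrow> 'b::{comm_monoid_add, t2_space}"
  assumes "finite A" "\<And>x. x \<notin> A \<Longrightarrow> f x = 0"
  shows "infsum f UNIV = sum f A"
  using assms infsum_cong_neutral[of UNIV A f f] by simp

lemma l2_add: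
  assumes "l2 c" "l2 d"
  shows "l2 (\<lambda>\<alpha>. c \<alpha> + d \<alpha>)"
  unfolding l2_def
proof (rule summable_on_comparison_test)
  show "(\<lambda>\<alpha>. 2 * ((cmod (c \<alpha>))\<^sup>2 + (cmod (d \<alpha>))\<^sup>2)) summable_on UNIV"
    by (intro summable_on_cmult_right summable_on_add assms[unfolded l2_def])
  fix \<alpha>
  have "(cmod (c \<alpha> + d \<alpha>))\<^sup>2 \<le> (cmod (c \<alpha>) + cmod (d \<alpha>))\<^sup>2"
    by (intro power_mono norm_triangle_ineq) auto
  also have "\<dots> \<le> 2 * ((cmod (c \<alpha>))\<^sup>2 + (cmod (d \<alpha>))\<^sup>2)"
    using sum_squares_ge_zero[of "cmod (c \<alpha>) - cmod (d \<alpha>)" 0] by (simp add: power2_eq_square algebra_simps)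
  finally show "(cmod (c \<alpha> + d \<alpha>))\<^sup>2 \<le> 2 * ((cmod (c \<alpha>))\<^sup>2 + (cmod (d \<alpha>))\<^sup>2)" .
qed auto

lemma l2_scale:
  assumes "l2 c"
  shows "l2 (\<lambda>\<alpha>. k * c \<alpha>)"
  using summable_on_cmult_right[OF assms[unfolded l2_def], of "(cmod k)\<^sup>2"]
  by (simp add: l2_def norm_mult power_mult_distrib)

lemma hom_part_add: "hom_part (\<lambda>\<alpha>. c \<alpha> + d \<alpha>) k X = hom_part c k X + hom_part d k X"
  by (simp add: hom_part_def cscale_add_left sum.distrib)

lemma hom_part_scale: "hom_part (\<lambda>\<alpha>. z * c \<alpha>) k X = cscale z (hom_part c k X)"
  by (simp add: hom_part_def cscale_sum_right)

lemma hom_part_sum: "hom_part (\<lambda>\<alpha>. \<Sum>j\<in>J. c j \<alpha>) k X = (\<Sum>j\<in>J. hom_part (c j) k X)"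
  unfolding hom_part_def cscale_sum_left by (rule sum.swap)

lemma of_coeff_add:
  assumes "l2 c" "l2 d"
  shows "of_coeff (\<lambda>\<alpha>. c \<alpha> + d \<alpha>) = (\<lambda>X\<in>nc_ball. of_coeff c X + of_coeff d X)"
  by (rule ext)
    (simp add: of_coeff_def restrict_def hom_part_add suminf_add summable_hom_part assms)

lemma of_coeff_scale:
  assumes "l2 c"
  shows "of_coeff (\<lambda>\<alpha>. z * c \<alpha>) = (\<lambda>X\<in>nc_ball. cscale z (of_coeff c X))"
  by (rule ext)
    (simp add: of_coeff_def restrict_def hom_part_scale summable_hom_part assms
      bounded_linear.suminf[OF bounded_linear_cscale])

text \<open>The second quantization of a matrix, acting as \<open>A\<^sup>\<otimes>\<^sup>k\<close> on the coefficients of degree \<open>k\<close>.\<close>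

primrec \<Gamma> :: "complex ^ 'n::finite ^ 'n \<Rightarrow> ('n list \<Rightarrow> complex) \<Rightarrow> 'n list \<Rightarrow> complex" where
  "\<Gamma> A c [] = c []"
| "\<Gamma> A c (i # \<beta>) = (\<Sum>j\<in>UNIV. A $ i $ j * \<Gamma> A (\<lambda>\<alpha>. c (j # \<alpha>)) \<beta>)"

lemma \<Gamma>_add: "\<Gamma> A (\<lambda>\<alpha>. c \<alpha> + d \<alpha>) \<beta> = \<Gamma> A c \<beta> + \<Gamma> A d \<beta>"
  by (induction \<beta> arbitrary: c d) (simp_all add: sum.distrib distrib_left)

lemma \<Gamma>_scale: "\<Gamma> A (\<lambda>\<alpha>. z * c \<alpha>) \<beta> = z * \<Gamma> A c \<beta>"
  by (induction \<beta> arbitrary: c) (simp_all add: sum_distrib_left mult.left_commute)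

lemma \<Gamma>_sum: "finite J \<Longrightarrow> \<Gamma> A (\<lambda>\<alpha>. \<Sum>j\<in>J. c j \<alpha>) \<beta> = (\<Sum>j\<in>J. \<Gamma> A (c j) \<beta>)"
proof (induction J rule: finite_induct)
  case empty
  show ?case using \<Gamma>_scale[where z = 0 and c = "\<lambda>_. 0"] by simp
qed (simp add: \<Gamma>_add)

text \<open>Functoriality of tensor powers; it reduces commutation of the operators to commutation
  of the matrices.\<close>

lemma \<Gamma>_mult: "\<Gamma> A (\<Gamma> B c) \<beta> = \<Gamma> (A ** B) c \<beta>"
proof (induction \<beta> arbitrary: c)
  case (Cons i \<beta>)
  have "\<Gamma> A (\<Gamma> B c) (i # \<beta>) =
    (\<Sum>j\<in>UNIV. \<Sum>l\<in>UNIV. A $ i $ j * (B $ j $ l * \<Gamma> (A ** B) (\<lambda>\<alpha>. c (l # \<alpha>)) \<beta>))"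
    by (simp add: \<Gamma>_sum \<Gamma>_scale Cons sum_distrib_left)
  also have "\<dots> = \<Gamma> (A ** B) c (i # \<beta>)"
    by (subst sum.swap) (simp add: matrix_matrix_mult_def sum_distrib_right mult.assoc)
  finally show ?case .
qed simp

text \<open>The adjoint of a tensor power is the tensor power of the adjoint. In a fixed degree all
  sums are finite, so the induction only interchanges them.\<close>

lemma \<Gamma>_adjoint:
  "(\<Sum>\<beta> | length \<beta> = k. \<Gamma> A c \<beta> * cnj (d \<beta>)) =
   (\<Sum>\<alpha> | length \<alpha> = k. c \<alpha> * cnj (\<Gamma> (conj_transpose A) d \<alpha>))"
proof (induction k arbitrary: c d)
  case (Suc k)
  have "(\<Sum>\<beta> | length \<beta> = Suc k. \<Gamma> A c \<beta> * cnj (d \<beta>)) =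
    (\<Sum>i\<in>UNIV. \<Sum>\<beta> | length \<beta> = k. \<Sum>j\<in>UNIV. A $ i $ j * (\<Gamma> A (\<lambda>\<alpha>. c (j # \<alpha>)) \<beta> * cnj (d (i # \<beta>))))"
    by (simp add: sum_words_Suc sum_distrib_right mult.assoc)
  also have "\<dots> = (\<Sum>i\<in>UNIV. \<Sum>j\<in>UNIV. A $ i $ j *
      (\<Sum>\<beta> | length \<beta> = k. \<Gamma> A (\<lambda>\<alpha>. c (j # \<alpha>)) \<beta> * cnj (d (i # \<beta>))))"
    by (intro sum.cong refl trans[OF sum.swap]) (simp add: sum_distrib_left)
  also have "\<dots> = (\<Sum>i\<in>UNIV. \<Sum>j\<in>UNIV. \<Sum>\<alpha> | length \<alpha> = k.
      A $ i $ j * (c (j # \<alpha>) * cnj (\<Gamma> (conj_transpose A) (\<lambda>\<beta>. d (i # \<beta>)) \<alpha>)))"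
    by (simp add: Suc sum_distrib_left)
  also have "\<dots> = (\<Sum>j\<in>UNIV. \<Sum>\<alpha> | length \<alpha> = k. \<Sum>i\<in>UNIV.
      A $ i $ j * (c (j # \<alpha>) * cnj (\<Gamma> (conj_transpose A) (\<lambda>\<beta>. d (i # \<beta>)) \<alpha>)))"
    by (subst sum.swap) (intro sum.cong refl sum.swap)
  also have "\<dots> = (\<Sum>\<alpha> | length \<alpha> = Suc k. c \<alpha> * cnj (\<Gamma> (conj_transpose A) d \<alpha>))"
    by (simp add: sum_words_Suc sum_distrib_left conj_transpose_def map_matrix_def transpose_def
      mult.left_commute)
  finally show ?case .
qed simp

lemma norm_vec_power2: "(norm (v :: complex ^ 'n::finite))\<^sup>2 = (\<Sum>i\<in>UNIV. (cmod (v $ i))\<^sup>2)"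
  by (simp add: norm_vec_def L2_set_def sum_nonneg)

text \<open>Tensor powers of a contraction are contractions: \<open>A\<close> acts on the first
  letter with the rest of the word fixed, and the induction hypothesis treats the rest with the
  first letter fixed.\<close>

lemma \<Gamma>_contraction:
  assumes A: "\<And>v. norm (A *v v) \<le> norm v"
  shows "(\<Sum>\<beta> | length \<beta> = k. (cmod (\<Gamma> A c \<beta>))\<^sup>2) \<le> (\<Sum>\<alpha> | length \<alpha> = k. (cmod (c \<alpha>))\<^sup>2)"
proof (induction k arbitrary: c)
  case (Suc k)
  have row: "(\<Sum>i\<in>UNIV. (cmod (\<Sum>j\<in>UNIV. A $ i $ j * v j))\<^sup>2) \<le> (\<Sum>j\<in>UNIV. (cmod (v j))\<^sup>2)" for v
    using power_mono[OF A[of "\<chi> j. v j"], of 2]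
    by (simp add: norm_vec_power2 matrix_vector_mult_def)
  have "(\<Sum>\<beta> | length \<beta> = Suc k. (cmod (\<Gamma> A c \<beta>))\<^sup>2) =
    (\<Sum>\<beta> | length \<beta> = k. \<Sum>i\<in>UNIV. (cmod (\<Sum>j\<in>UNIV. A $ i $ j * \<Gamma> A (\<lambda>\<alpha>. c (j # \<alpha>)) \<beta>))\<^sup>2)"
    unfolding sum_words_Suc by (subst sum.swap) simp
  also have "\<dots> \<le> (\<Sum>\<beta> | length \<beta> = k. \<Sum>j\<in>UNIV. (cmod (\<Gamma> A (\<lambda>\<alpha>. c (j # \<alpha>)) \<beta>))\<^sup>2)"
    by (intro sum_mono row)
  also have "\<dots> = (\<Sum>j\<in>UNIV. \<Sum>\<beta> | length \<beta> = k. (cmod (\<Gamma> A (\<lambda>\<alpha>. c (j # \<alpha>)) \<beta>))\<^sup>2)"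
    by (rule sum.swap)
  also have "\<dots> \<le> (\<Sum>j\<in>UNIV. \<Sum>\<alpha> | length \<alpha> = k. (cmod (c (j # \<alpha>)))\<^sup>2)"
    by (intro sum_mono Suc)
  finally show ?case by (simp only: sum_words_Suc)
qed simp

lemma \<Gamma>_l2:
  assumes A: "\<And>v. norm (A *v v) \<le> norm v" and c: "l2 c"
  shows "l2 (\<Gamma> A c)" "(\<Sum>\<^sub>\<infinity>\<beta>. (cmod (\<Gamma> A c \<beta>))\<^sup>2) \<le> (\<Sum>\<^sub>\<infinity>\<alpha>. (cmod (c \<alpha>))\<^sup>2)"
proof -
  have "(\<Sum>\<beta> | length \<beta> < N. (cmod (\<Gamma> A c \<beta>))\<^sup>2) \<le> (\<Sum>\<^sub>\<infinity>\<alpha>. (cmod (c \<alpha>))\<^sup>2)" for N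
    by (rule order_trans[OF sum_words_less_mono[OF \<Gamma>_contraction[OF A]] l2_words_le]) (simp_all add: c)
  from l2_bound[of "\<Gamma> A c", OF this]
  show "l2 (\<Gamma> A c)" "(\<Sum>\<^sub>\<infinity>\<beta>. (cmod (\<Gamma> A c \<beta>))\<^sup>2) \<le> (\<Sum>\<^sub>\<infinity>\<alpha>. (cmod (c \<alpha>))\<^sup>2)" .
qed

lemma \<Gamma>_adjoint_infsum:
  assumes "\<And>v. norm (A *v v) \<le> norm v" "\<And>v. norm (conj_transpose A *v v) \<le> norm v" "l2 c" "l2 d"
  shows "(\<Sum>\<^sub>\<infinity>\<beta>. \<Gamma> A c \<beta> * cnj (d \<beta>)) = (\<Sum>\<^sub>\<infinity>\<alpha>. c \<alpha> * cnj (\<Gamma> (conj_transpose A) d \<alpha>))"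
proof -
  have "(\<lambda>\<beta>. \<Gamma> A c \<beta> * cnj (d \<beta>)) summable_on UNIV"
    "(\<lambda>\<alpha>. c \<alpha> * cnj (\<Gamma> (conj_transpose A) d \<alpha>)) summable_on UNIV"
    using assms by (auto intro!: l2_inner_summable \<Gamma>_l2)
  from this[THEN infsum_words_lim] show ?thesis
    unfolding sum_words_less_cong[OF \<Gamma>_adjoint] by (rule LIMSEQ_unique)
qed

section \<open>Substitution of a linear tuple\<close>

lemma cblinops_cscale: "T \<in> cblinops \<Longrightarrow> cscale c T \<in> cblinops"
  by (simp add: cblinops_def cscale.rep_eq scaleC_scaleC mult.commute)

text \<open>This is why \<open>\<Gamma> A\<close> describes composition with a linear map: expanding
  the product of the sums letter by letter collects the coefficient
  \<open>\<Gamma> A c \<beta>\<close> at the word \<beta>. Complex linearity of the entries moves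
  the scalars to the front.\<close>

lemma hom_part_tuple_mult:
  assumes X: "\<And>i. X $ i \<in> cblinops"
  shows "hom_part c k (tuple_mult X A) = hom_part (\<Gamma> A c) k X"
proof (rule blinfun_eqI)
  have XA: "tuple_mult X A $ j \<in> cblinops" for j
    by (simp add: tuple_mult_def cblinops_sum cblinops_cscale X)
  show "blinfun_apply (hom_part c k (tuple_mult X A)) h = blinfun_apply (hom_part (\<Gamma> A c) k X) h" for h
  proof (induction k arbitrary: c)
    case 0
    show ?case by (simp add: hom_part_def)
  next
    case (Suc k)
    have scale: "blinfun_apply (X $ i) (scaleC z x) = scaleC z (blinfun_apply (X $ i) x)" for i z x
      using X by (simp add: cblinops_def)
    show ?case
      unfolding hom_part_Suc[OF X] hom_part_Suc[OF XA] Suc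
      by (simp add: hom_part_sum hom_part_scale tuple_mult_def blinfun.sum_left blinfun.sum_right
          cscale.rep_eq scale) (rule sum.swap)
  qed
qed

section \<open>The Hermitian form on C^n and normal matrices\<close>

definition herm :: "complex ^ 'n::finite \<Rightarrow> complex ^ 'n \<Rightarrow> complex" where
  "herm u v = (\<Sum>i\<in>UNIV. u $ i * cnj (v $ i))"

lemma herm_self: "herm v v = of_real ((norm v)\<^sup>2)"
  by (simp add: herm_def norm_vec_power2 complex_norm_square del: of_real_power)

lemma herm_conj_transpose: "herm (A *v u) v = herm u (conj_transpose A *v v)"
proof -
  have "herm (A *v u) v = (\<Sum>i\<in>UNIV. \<Sum>j\<in>UNIV. u $ j * (A $ i $ j * cnj (v $ i)))"
    by (simp add: herm_def matrix_vector_mult_def sum_distrib_right mult.left_commute mult.assoc)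
  also have "\<dots> = herm u (conj_transpose A *v v)"
    by (subst sum.swap)
      (simp add: herm_def matrix_vector_mult_def sum_distrib_left conj_transpose_def map_matrix_def transpose_def)
  finally show ?thesis .
qed

lemma conj_transpose_conj_transpose [simp]: "conj_transpose (conj_transpose A) = A"
  by (simp add: conj_transpose_def map_matrix_def transpose_def vec_eq_iff)

text \<open>Both squared norms are values at \<open>v\<close> of one form, because the two products
  of \<open>A\<close> with its adjoint agree. It carries contractivity from \<open>A\<close> to its
  adjoint and back.\<close>

lemma norm_conj_transpose:
  assumes "normal_matrix A"
  shows "norm (conj_transpose A *v v) = norm (A *v v)"
proof -
  have "herm (A *v v) (A *v v) = herm v ((conj_transpose A ** A) *v v)"
    by (simp add: herm_conj_transpose matrix_vector_mul_assoc)
  also have "\<dots> = herm v ((A ** conj_transpose A) *v v)"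
    using assms by (simp add: normal_matrix_def)
  also have "\<dots> = herm (conj_transpose A *v v) (conj_transpose A *v v)"
    by (simp add: herm_conj_transpose matrix_vector_mul_assoc)
  finally show ?thesis
    unfolding herm_self of_real_eq_iff by simp
qed

section \<open>Scalar operators, monomials and the lowest degrees\<close>

lemma H2_inner_commute: "H2_inner f g = cnj (H2_inner g f)"
  unfolding H2_inner_def infsum_cnj[symmetric] by (simp add: mult.commute)

lemma scalar_cblinops [simp]: "cscale c id_blinfun \<in> cblinops"
  by (rule cblinops_cscale) (simp add: cblinops_def)

lemma op_adjoint_scalar: "op_adjoint (cscale c id_blinfun) = cscale (cnj c) id_blinfun"
  by (rule op_adjoint_eqI) (simp add: cscale.rep_eq cinner_scaleC_left cinner_scaleC_right)

definition monomial :: "'n list \<Rightarrow> 'n list \<Rightarrow> complex" where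
  "monomial \<alpha> \<beta> = of_bool (\<beta> = \<alpha>)"

lemma l2_monomial: "l2 (monomial \<alpha>)"
  unfolding l2_def
  by (rule summable_on_cong_neutral[THEN iffD1, OF _ _ _ summable_on_finite[of "{\<alpha>}"]])
    (auto simp: monomial_def)

lemma hom_part_monomial: "hom_part (monomial \<alpha>) k X = (if k = length \<alpha> then word_prod X \<alpha> else 0)"
  by (auto simp: hom_part_def monomial_def of_bool_def if_distrib[of "\<lambda>z. cscale z _"] sum.delta cong: if_cong)

lemma sum_words_1: "(\<Sum>\<alpha> | length \<alpha> = 1. F \<alpha>) = (\<Sum>i\<in>UNIV. F [i :: 'n::finite])"
  using sum_words_Suc[where k = 0 and F = F] by simp

lemma blinfun_compose_id_right [simp]: "T o\<^sub>L id_blinfun = T"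
  by (rule blinfun_eqI) simp

lemma blinfun_compose_assoc: "S o\<^sub>L (T o\<^sub>L U) = (S o\<^sub>L T) o\<^sub>L U"
  by (rule blinfun_eqI) simp

lemma of_coeff_monomial: "of_coeff (monomial \<alpha>) = (\<lambda>X\<in>nc_ball. word_prod X \<alpha>)"
  unfolding of_coeff_def hom_part_monomial
  by (intro restrict_ext) (rule sums_unique[OF sums_single, symmetric])

lemma hom_part_0: "hom_part c 0 X = cscale (c []) id_blinfun"
  by (simp add: hom_part_def)

lemma hom_part_1: "hom_part c 1 X = (\<Sum>i\<in>UNIV. cscale (c [i]) (X $ i))"
  unfolding hom_part_def sum_words_1 by simp

subsection \<open>The Hardy space\<close>

context
  assumes infinite_dim: "\<forall>B :: 'h::complex_hilbert set. finite B \<longrightarrow> module.span scaleC B \<noteq> UNIV"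
begin

text \<open>The tuple acts as a nilpotent weighted shift along the letters of the word, so that \<open>X\<^sub>\<beta>\<close>
  carries the last basis vector to a multiple of the first one only if \<open>\<beta> = \<alpha>\<close>.\<close>

lemma word_functional:
  fixes \<alpha> :: "'n::finite list"
  obtains X :: "('h \<Rightarrow>\<^sub>L 'h) ^ 'n" and u v c where "X \<in> nc_ball" "c \<noteq> 0"
    "\<And>\<beta>. cinner (blinfun_apply (word_prod X \<beta>) u) v = (if \<beta> = \<alpha> then c else 0)"
proof -
  define k where "k = length \<alpha>"
  obtain e :: "nat \<Rightarrow> 'h" where "\<forall>p<Suc k. \<forall>q<Suc k. cinner (e p) (e q) = of_bool (p = q)"
    using orthonormal_exists[OF infinite_dim] by blast
  then have e: "cinner (e p) (e q) = of_bool (p = q)" if "p \<le> k" "q \<le> k" for p q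
    using that by (simp add: less_Suc_eq_le)
  define Y :: "('h \<Rightarrow>\<^sub>L 'h) ^ 'n" where
    "Y = (\<chi> j. \<Sum>q\<in>{q. q < k \<and> \<alpha> ! q = j}. rank_one (e q) (e (Suc q)))"
  have "Y $ j \<in> cblinops" for j
    by (auto simp: Y_def intro!: cblinops_sum rank_one_cblinops)
  then obtain r where r: "r > 0" "(\<chi> j. r *\<^sub>R Y $ j) \<in> nc_ball"
    using scaled_in_nc_ball[of Y] by blast
  define X :: "('h \<Rightarrow>\<^sub>L 'h) ^ 'n" where "X = (\<chi> j. r *\<^sub>R Y $ j)"
  have shift: "cinner (blinfun_apply (X $ j) x) (e p) =
    (if p < k \<and> \<alpha> ! p = j then of_real r * cinner x (e (Suc p)) else 0)" if "p \<le> k" for j x p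
  proof -
    have "cinner (blinfun_apply (X $ j) x) (e p) =
      of_real r * (\<Sum>q\<in>{q. q < k \<and> \<alpha> ! q = j}. cinner x (e (Suc q)) * of_bool (q = p))"
      using that by (simp add: X_def Y_def blinfun.scaleR_left blinfun.sum_left scaleC_of_real[symmetric]
        cinner_scaleC_left cinner_simps rank_one.rep_eq e)
    also have "\<dots> = (if p < k \<and> \<alpha> ! p = j then of_real r * cinner x (e (Suc p)) else 0)"
      by (simp add: of_bool_def if_distrib sum.delta cong: if_cong)
    finally show ?thesis .
  qed
  \<comment> \<open>Testing against \<open>e p\<close> detects the suffix of \<alpha> from position
    \<open>p\<close>. The general \<open>p\<close> is needed for the induction, where each letter of
    \<beta> advances the position by one; \<open>p = 0\<close> gives the claim.\<close>
  have coeff: "cinner (blinfun_apply (word_prod X \<beta>) (e k)) (e p) =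
    (if \<beta> = drop p \<alpha> then of_real r ^ length \<beta> else 0)" if "p \<le> k" for \<beta> p
    using that
  proof (induction \<beta> arbitrary: p)
    case Nil
    then show ?case by (auto simp: e k_def)
  next
    case (Cons j \<beta>)
    show ?case
    proof (cases "p < k")
      case True
      then have "drop p \<alpha> = \<alpha> ! p # drop (Suc p) \<alpha>" by (simp add: k_def Cons_nth_drop_Suc)
      then show ?thesis using True Cons.IH[of "Suc p"] by (auto simp: shift)
    next
      case False
      then have "drop p \<alpha> = []" using Cons.prems by (simp add: k_def)
      then show ?thesis using False Cons.prems by (simp add: shift)
    qed
  qed
  show ?thesis
    by (rule that[of X "of_real r ^ k" "e k" "e 0"]) (use r coeff[of 0] in \<open>auto simp: X_def k_def\<close>)
qed

text \<open>The functional from \<open>word_functional\<close> annihilates every term of the series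
  except the one of \<alpha>, so the value of \<open>f\<close> at that tuple determines the
  coefficient.\<close>

lemma free_series_unique:
  fixes f :: "('h \<Rightarrow>\<^sub>L 'h) ^ 'n::finite \<Rightarrow> ('h \<Rightarrow>\<^sub>L 'h)"
  assumes "has_free_series f a" "has_free_series f b"
  shows "a = b"
proof
  fix \<alpha> :: "'n list"
  obtain X :: "('h \<Rightarrow>\<^sub>L 'h) ^ 'n" and u v c where X: "X \<in> nc_ball" "c \<noteq> 0"
    "\<And>\<beta>. cinner (blinfun_apply (word_prod X \<beta>) u) v = (if \<beta> = \<alpha> then c else 0)"
    by (rule word_functional[of \<alpha>]) (rule that)
  have "cinner (blinfun_apply (f X) u) v = d \<alpha> * c" if "has_free_series f d" for d
  proof -
    have "bounded_linear (\<lambda>T. cinner (blinfun_apply T u) v)"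
      by (intro bounded_linear_compose[OF bounded_linear_cinner_left] blinfun.bounded_linear_left)
    then have "(\<lambda>k. cinner (blinfun_apply (hom_part d k X) u) v) sums cinner (blinfun_apply (f X) u) v"
      using free_seriesD[OF that X(1)] by (rule bounded_linear.sums)
    moreover have "cinner (blinfun_apply (hom_part d k X) u) v = (if k = length \<alpha> then d \<alpha> * c else 0)" for k
      by (auto simp: hom_part_def blinfun.sum_left cinner_simps cscale.rep_eq cinner_scaleC_left X
          if_distrib sum.delta cong: if_cong)
    moreover have "(\<lambda>k. if k = length \<alpha> then d \<alpha> * c else 0) sums (d \<alpha> * c)"
      by (rule sums_single)
    ultimately show ?thesis by (simp add: sums_unique2)
  qed
  then show "a \<alpha> = b \<alpha>" using assms X(2) by (metis mult_right_cancel)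
qed

section \<open>The Hardy space in terms of coefficients\<close>

lemma free_coeff_eqI:
  fixes f :: "('h \<Rightarrow>\<^sub>L 'h) ^ 'n::finite \<Rightarrow> ('h \<Rightarrow>\<^sub>L 'h)"
  assumes "has_free_series f a"
  shows "free_coeff f = a"
  unfolding free_coeff_def using assms free_series_unique by blast

lemma free_coeff_of_coeff [simp]:
  assumes "l2 c"
  shows "free_coeff (of_coeff c :: ('h \<Rightarrow>\<^sub>L 'h) ^ 'n::finite \<Rightarrow> ('h \<Rightarrow>\<^sub>L 'h)) = c"
  by (rule free_coeff_eqI[OF of_coeff_series[OF assms]])

lemma of_coeff_in_H2:
  assumes "l2 c"
  shows "(of_coeff c :: ('h \<Rightarrow>\<^sub>L 'h) ^ 'n::finite \<Rightarrow> ('h \<Rightarrow>\<^sub>L 'h)) \<in> H2_ball"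
  using assms of_coeff_series[OF assms]
  unfolding H2_ball_def by (auto simp: free_holomorphic_def l2_def[symmetric]) (auto simp: of_coeff_def)

lemma H2_ball_series:
  fixes f :: "('h \<Rightarrow>\<^sub>L 'h) ^ 'n::finite \<Rightarrow> ('h \<Rightarrow>\<^sub>L 'h)"
  assumes "f \<in> H2_ball"
  shows "has_free_series f (free_coeff f)" "l2 (free_coeff f)" "f = of_coeff (free_coeff f)"
proof -
  obtain a where "has_free_series f a"
    using assms by (auto simp: H2_ball_def free_holomorphic_def)
  then show s: "has_free_series f (free_coeff f)" using free_coeff_eqI by metis
  show "l2 (free_coeff f)" using assms by (simp add: H2_ball_def l2_def)
  show "f = of_coeff (free_coeff f)" using assms by (intro of_coeff_unique s) (simp add: H2_ball_def)
qed

lemma comp_op_of_coeff: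
  fixes \<phi> :: "('h \<Rightarrow>\<^sub>L 'h) ^ 'n::finite \<Rightarrow> ('h \<Rightarrow>\<^sub>L 'h) ^ 'n"
  assumes "l2 c"
  shows "comp_op \<phi> (of_coeff c) = (\<lambda>X\<in>nc_ball. \<Sum>k. hom_part c k (\<phi> X))"
  by (simp add: comp_op_def free_coeff_of_coeff[OF assms] hom_part_def)

lemma comp_op_monomial:
  fixes \<phi> :: "('h \<Rightarrow>\<^sub>L 'h) ^ 'n::finite \<Rightarrow> ('h \<Rightarrow>\<^sub>L 'h) ^ 'n"
  shows "comp_op \<phi> (of_coeff (monomial \<alpha>)) = (\<lambda>X\<in>nc_ball. word_prod (\<phi> X) \<alpha>)"
  unfolding comp_op_of_coeff[OF l2_monomial] hom_part_monomial
  using sums_single[of "length \<alpha>" "\<lambda>_. word_prod (\<phi> _) \<alpha>", THEN sums_unique] by (simp add: restrict_def fun_eq_iff)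

lemma H2_inner_monomial:
  fixes f :: "('h \<Rightarrow>\<^sub>L 'h) ^ 'n::finite \<Rightarrow> ('h \<Rightarrow>\<^sub>L 'h)"
  shows "H2_inner f (of_coeff (monomial \<alpha>)) = free_coeff f \<alpha>"
proof -
  have "H2_inner f (of_coeff (monomial \<alpha>)) = (\<Sum>\<beta>\<in>{\<alpha>}. free_coeff f \<beta> * cnj (monomial \<alpha> \<beta>))"
    unfolding H2_inner_def free_coeff_of_coeff[OF l2_monomial]
    by (rule infsum_finite_support) (auto simp: monomial_def)
  then show ?thesis by (simp add: monomial_def)
qed

lemma H2_inner_self:
  fixes f :: "('h \<Rightarrow>\<^sub>L 'h) ^ 'n::finite \<Rightarrow> ('h \<Rightarrow>\<^sub>L 'h)"
  assumes "f \<in> H2_ball"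
  shows "H2_inner f f = of_real (\<Sum>\<^sub>\<infinity>\<alpha>. (cmod (free_coeff f \<alpha>))\<^sup>2)"
proof -
  have "((\<lambda>\<alpha>. (cmod (free_coeff f \<alpha>))\<^sup>2) has_sum (\<Sum>\<^sub>\<infinity>\<alpha>. (cmod (free_coeff f \<alpha>))\<^sup>2)) UNIV"
    using H2_ball_series(2)[OF assms] by (simp add: l2_def)
  then have "((\<lambda>\<alpha>. complex_of_real ((cmod (free_coeff f \<alpha>))\<^sup>2)) has_sum
      of_real (\<Sum>\<^sub>\<infinity>\<alpha>. (cmod (free_coeff f \<alpha>))\<^sup>2)) UNIV"
    by (simp only: has_sum_of_real_iff)
  then show ?thesis
    unfolding H2_inner_def complex_norm_square by (rule infsumI)
qed

section \<open>Linear substitutions give normal operators\<close>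

lemma H2_bounded_second_quantization:
  fixes T :: "('h, 'n::finite) H2_op"
  assumes A: "\<And>v. norm (A *v v) \<le> norm v"
    and T: "\<And>f. f \<in> H2_ball \<Longrightarrow> T f = of_coeff (\<Gamma> A (free_coeff f))"
  shows "H2_bounded_op T"
  unfolding H2_bounded_op_def
\<comment> \<open>The operator bound is 1 because \<open>\<Gamma> A\<close> is a contraction on
  coefficients.\<close>
proof (intro conjI ballI allI exI[of _ 1])
  have T_of_coeff: "T (of_coeff c) = of_coeff (\<Gamma> A c)" if "l2 c" for c
    using T[OF of_coeff_in_H2[OF that]] by (simp add: free_coeff_of_coeff that)
  fix f :: "('h \<Rightarrow>\<^sub>L 'h) ^ 'n \<Rightarrow> ('h \<Rightarrow>\<^sub>L 'h)" assume f: "f \<in> H2_ball"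
  note f_l2 = H2_ball_series(2)[OF f]
  note f_eq = H2_ball_series(3)[OF f]
  show "T f \<in> H2_ball"
    unfolding T[OF f] by (intro of_coeff_in_H2 \<Gamma>_l2 A f_l2)
  show "H2_norm (T f) \<le> 1 * H2_norm f"
    using \<Gamma>_l2(2)[OF A f_l2] by (simp add: T[OF f] H2_norm_def free_coeff_of_coeff \<Gamma>_l2[OF A f_l2])
  show "T (\<lambda>X\<in>nc_ball. cscale c (f X)) = (\<lambda>X\<in>nc_ball. cscale c (T f X))" for c
  proof -
    have "(\<lambda>X\<in>nc_ball. cscale c (f X)) = of_coeff (\<lambda>\<alpha>. c * free_coeff f \<alpha>)"
      by (subst f_eq) (rule of_coeff_scale[OF f_l2, symmetric])
    moreover have "\<Gamma> A (\<lambda>\<alpha>. c * free_coeff f \<alpha>) = (\<lambda>\<beta>. c * \<Gamma> A (free_coeff f) \<beta>)"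
      by (rule ext) (rule \<Gamma>_scale)
    ultimately show ?thesis
      using of_coeff_scale[OF \<Gamma>_l2(1)[OF A f_l2]] by (simp add: T_of_coeff l2_scale f_l2 T[OF f])
  qed
  fix g :: "('h \<Rightarrow>\<^sub>L 'h) ^ 'n \<Rightarrow> ('h \<Rightarrow>\<^sub>L 'h)" assume g: "g \<in> H2_ball"
  note g_l2 = H2_ball_series(2)[OF g]
  note g_eq = H2_ball_series(3)[OF g]
  show "T (\<lambda>X\<in>nc_ball. f X + g X) = (\<lambda>X\<in>nc_ball. T f X + T g X)"
  proof -
    have "(\<lambda>X\<in>nc_ball. f X + g X) = of_coeff (\<lambda>\<alpha>. free_coeff f \<alpha> + free_coeff g \<alpha>)"
      by (subst f_eq, subst g_eq) (rule of_coeff_add[OF f_l2 g_l2, symmetric])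
    moreover have "\<Gamma> A (\<lambda>\<alpha>. free_coeff f \<alpha> + free_coeff g \<alpha>) =
        (\<lambda>\<beta>. \<Gamma> A (free_coeff f) \<beta> + \<Gamma> A (free_coeff g) \<beta>)"
      by (rule ext) (rule \<Gamma>_add)
    ultimately show ?thesis
      using of_coeff_add[OF \<Gamma>_l2(1)[OF A f_l2] \<Gamma>_l2(1)[OF A g_l2]]
      by (simp add: T_of_coeff l2_add f_l2 g_l2 T[OF f] T[OF g])
  qed
qed

text \<open>On coefficients the operator is \<open>\<Gamma> A\<close>, and the second quantization
  of the conjugate transpose serves as its adjoint. The two commute by \<open>\<Gamma>_mult\<close>
  and normality of \<open>A\<close>.\<close>

lemma H2_normal_tuple_mult:
  fixes \<phi> :: "('h \<Rightarrow>\<^sub>L 'h) ^ 'n::finite \<Rightarrow> ('h \<Rightarrow>\<^sub>L 'h) ^ 'n"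
  assumes normal: "normal_matrix A" and A: "\<And>v. norm (A *v v) \<le> norm v"
    and \<phi>: "\<And>X. X \<in> nc_ball \<Longrightarrow> \<phi> X = tuple_mult X A"
  shows "H2_normal (comp_op \<phi>)"
proof -
  have A': "norm (conj_transpose A *v v) \<le> norm v" for v
    using A norm_conj_transpose[OF normal] by simp
  define S :: "('h, 'n) H2_op" where "S f = of_coeff (\<Gamma> (conj_transpose A) (free_coeff f))" for f
  have T: "comp_op \<phi> f = of_coeff (\<Gamma> A (free_coeff f))" if f: "f \<in> H2_ball" for f
  proof -
    have "comp_op \<phi> f = (\<lambda>X\<in>nc_ball. \<Sum>k. hom_part (free_coeff f) k (\<phi> X))"
      by (simp add: comp_op_def hom_part_def)
    also have "\<dots> = of_coeff (\<Gamma> A (free_coeff f))"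
      unfolding of_coeff_def by (intro restrict_ext) (simp add: \<phi> hom_part_tuple_mult nc_ball_def)
    finally show ?thesis .
  qed
  have S_bounded: "H2_bounded_op S"
    by (rule H2_bounded_second_quantization[OF A']) (simp_all add: S_def)
  have l2: "l2 (free_coeff f)" "l2 (\<Gamma> A (free_coeff f))" "l2 (\<Gamma> (conj_transpose A) (free_coeff f))"
    if "f \<in> H2_ball" for f :: "('h \<Rightarrow>\<^sub>L 'h) ^ 'n \<Rightarrow> ('h \<Rightarrow>\<^sub>L 'h)"
    using H2_ball_series(2)[OF that] by (simp_all add: \<Gamma>_l2 A A')
  have adjoint: "H2_is_adjoint (comp_op \<phi>) S"
    unfolding H2_is_adjoint_def
    by (auto simp: S_bounded S_def T H2_inner_def free_coeff_of_coeff l2 intro!: \<Gamma>_adjoint_infsum A A')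
  have mult: "\<Gamma> B (\<Gamma> C c) = \<Gamma> (B ** C) c" for B C :: "complex ^ 'n ^ 'n" and c
    by (rule ext) (rule \<Gamma>_mult)
  have "S (comp_op \<phi> f) = comp_op \<phi> (S f)" if f: "f \<in> H2_ball" for f
  proof -
    have "S (comp_op \<phi> f) = of_coeff (\<Gamma> (conj_transpose A ** A) (free_coeff f))"
      unfolding T[OF f] S_def free_coeff_of_coeff[OF l2(2)[OF f]] mult ..
    also have "\<dots> = of_coeff (\<Gamma> (A ** conj_transpose A) (free_coeff f))"
      using normal by (simp add: normal_matrix_def)
    also have "\<dots> = comp_op \<phi> (S f)"
      using T[of "S f"] S_bounded f
      by (simp add: H2_bounded_op_def) (simp add: S_def free_coeff_of_coeff l2 mult f)
    finally show ?thesis .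
  qed
  moreover have "H2_bounded_op (comp_op \<phi>)"
    by (rule H2_bounded_second_quantization[OF A T])
  ultimately show ?thesis using adjoint by (auto simp: H2_normal_def)
qed

section \<open>Scalar tuples and the norm of the matrix\<close>

lemma scalars_in_nc_ball:
  "(\<chi> i::'n::finite. cscale (c i) (id_blinfun :: 'h \<Rightarrow>\<^sub>L 'h)) \<in> nc_ball \<longleftrightarrow> (\<Sum>i\<in>UNIV. (cmod (c i))\<^sup>2) < 1"
proof -
  \<comment> \<open>A unit vector shows that the space is nonzero, so the identity has norm exactly
    1.\<close>
  obtain e :: "nat \<Rightarrow> 'h" where "cinner (e 0) (e 0) = 1"
    using orthonormal_exists[OF infinite_dim, of 1] by auto
  then have "e 0 \<noteq> 0" by auto
  then have norm_id: "norm (id_blinfun :: 'h \<Rightarrow>\<^sub>L 'h) = 1"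
    using norm_blinfun[of "id_blinfun :: 'h \<Rightarrow>\<^sub>L 'h" "e 0"] norm_blinfun_id_le[where 'a = 'h] by simp
  have "(cscale z id_blinfun :: 'h \<Rightarrow>\<^sub>L 'h) o\<^sub>L cscale (cnj z) id_blinfun = (cmod z)\<^sup>2 *\<^sub>R id_blinfun" for z
    by (rule blinfun_eqI)
      (simp add: cscale.rep_eq scaleC_scaleC blinfun.scaleR_left complex_norm_square[symmetric] scaleC_of_real
        del: of_real_power)
  then have "(\<Sum>i\<in>UNIV. (cscale (c i) id_blinfun :: 'h \<Rightarrow>\<^sub>L 'h) o\<^sub>L op_adjoint (cscale (c i) id_blinfun)) =
    (\<Sum>i\<in>UNIV. (cmod (c i))\<^sup>2) *\<^sub>R id_blinfun"
    by (simp add: op_adjoint_scalar scaleR_left.sum)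
  then show ?thesis
    by (simp add: nc_ball_def norm_id sum_nonneg)
qed

text \<open>Scalar tuples embed the Euclidean unit ball, so the row action \<open>W\<close> of
  \<open>A\<close> is contractive. Up to complex conjugation \<open>W\<close> is the adjoint of
  \<open>A\<close>, and normality transfers the bound to \<open>A\<close>.\<close>

lemma nc_ball_contraction:
  fixes A :: "complex ^ 'n::finite ^ 'n"
  assumes normal: "normal_matrix A"
    and ball: "\<And>X :: ('h \<Rightarrow>\<^sub>L 'h) ^ 'n. X \<in> nc_ball \<Longrightarrow> tuple_mult X A \<in> nc_ball"
  shows "norm (A *v v) \<le> norm v"
proof -
  define W where "W w = (\<chi> j. \<Sum>i\<in>UNIV. w $ i * A $ i $ j)" for w :: "complex ^ 'n"
  have unit: "norm (W w) < 1" if "norm w < 1" for w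
  proof -
    have lt: "(norm x)\<^sup>2 < 1 \<longleftrightarrow> norm x < 1" for x :: "complex ^ 'n"
      using power2_eq_1_iff[of "norm x"] by (simp add: abs_square_less_1)
    have "(\<Sum>i\<in>UNIV. (cmod (w $ i))\<^sup>2) < 1"
      using that by (simp add: norm_vec_power2[symmetric] lt)
    then have "(\<chi> i. cscale (w $ i) (id_blinfun :: 'h \<Rightarrow>\<^sub>L 'h)) \<in> nc_ball"
      by (simp add: scalars_in_nc_ball)
    then have "tuple_mult (\<chi> i. cscale (w $ i) (id_blinfun :: 'h \<Rightarrow>\<^sub>L 'h)) A \<in> nc_ball"
      by (rule ball)
    moreover have "tuple_mult (\<chi> i. cscale (w $ i) (id_blinfun :: 'h \<Rightarrow>\<^sub>L 'h)) A =
        (\<chi> j. cscale (W w $ j) id_blinfun)"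
      by (simp add: tuple_mult_def W_def cscale_sum_left mult.commute)
    ultimately have "(\<Sum>i\<in>UNIV. (cmod (W w $ i))\<^sup>2) < 1"
      by (simp add: scalars_in_nc_ball)
    then show ?thesis by (simp add: norm_vec_power2[symmetric] lt)
  qed
  have W: "norm (W w) \<le> norm w" for w
  proof (rule ccontr)
    assume *: "\<not> norm (W w) \<le> norm w"
    then have pos: "norm (W w) > 0" using norm_ge_zero[of w] by linarith
    \<comment> \<open>Scaling by \<open>t\<close> puts the image on the unit sphere while the
      argument stays inside the open ball, against \<open>unit\<close>.\<close>
    define t where "t = 1 / norm (W w)"
    have "W (t *\<^sub>R w) = t *\<^sub>R W w"
      by (simp add: W_def vec_eq_iff scaleR_sum_right)
    moreover have "norm (t *\<^sub>R w) < 1" using * pos by (simp add: t_def)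
    ultimately show False using unit[of "t *\<^sub>R w"] pos by (simp add: t_def)
  qed
  define w where "w = (\<chi> i. cnj (v $ i))"
  have "conj_transpose A *v v = (\<chi> j. cnj (W w $ j))"
    by (simp add: vec_eq_iff matrix_vector_mult_def conj_transpose_def map_matrix_def transpose_def
        W_def w_def mult.commute)
  then have "norm (conj_transpose A *v v) = norm (W w)" by (simp add: norm_vec_def)
  moreover have "norm w = norm v" by (simp add: w_def norm_vec_def)
  ultimately show ?thesis using W[of w] norm_conj_transpose[OF normal] by simp
qed

text \<open>A tuple whose only nonzero entry squares to zero detects the coefficients of degree at most one.\<close>

lemma nilpotent_tuple:
  fixes i :: "'n::finite"
  obtains X :: "('h \<Rightarrow>\<^sub>L 'h) ^ 'n" where "X \<in> nc_ball" "X $ i \<noteq> 0" "X $ i o\<^sub>L X $ i = 0"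
    "\<And>f c. has_free_series f c \<Longrightarrow> f X = cscale (c []) id_blinfun + cscale (c [i]) (X $ i)"
proof -
  obtain e :: "nat \<Rightarrow> 'h" where e: "\<forall>p<2. \<forall>q<2. cinner (e p) (e q) = of_bool (p = q)"
    using orthonormal_exists[OF infinite_dim] by blast
  define Y :: "('h \<Rightarrow>\<^sub>L 'h) ^ 'n" where "Y = (\<chi> j. if j = i then rank_one (e 0) (e 1) else 0)"
  have "Y $ j \<in> cblinops" for j by (simp add: Y_def rank_one_cblinops cblinops_zero)
  then obtain r where r: "r > 0" "(\<chi> j. r *\<^sub>R Y $ j) \<in> nc_ball"
    using scaled_in_nc_ball[of Y] by blast
  define X :: "('h \<Rightarrow>\<^sub>L 'h) ^ 'n" where "X = (\<chi> j. r *\<^sub>R Y $ j)"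
  \<comment> \<open>The range of the rank-one operator is spanned by \<open>e 0\<close>, which is
    orthogonal to \<open>e 1\<close>.\<close>
  have nil: "X $ j o\<^sub>L X $ l = 0" for j l
    by (rule blinfun_eqI)
      (simp add: X_def Y_def blinfun.scaleR_left blinfun.scaleR_right rank_one.rep_eq cinner_scaleC_left e)
  have "blinfun_apply (X $ i) (e 1) = r *\<^sub>R e 0"
    using e by (simp add: X_def Y_def blinfun.scaleR_left rank_one.rep_eq)
  moreover have "e 0 \<noteq> 0" using e by (metis cinner_zero_left of_bool_eq(2) zero_less_numeral zero_neq_one)
  ultimately have Xi: "X $ i \<noteq> 0" using r by auto
  have high: "word_prod X \<alpha> = 0" if "length \<alpha> \<ge> 2" for \<alpha>
  proof -
    obtain j l \<beta> where "\<alpha> = j # l # \<beta>"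
      using \<open>length \<alpha> \<ge> 2\<close> by (cases \<alpha> rule: remdups_adj.cases) auto
    then show ?thesis
      by (simp add: blinfun_compose_assoc nil)
  qed
  have "f X = cscale (c []) id_blinfun + cscale (c [i]) (X $ i)" if "has_free_series f c" for f c
  proof -
    have "X \<in> nc_ball" using r by (simp add: X_def)
    with that have "(\<lambda>k. hom_part c k X) sums f X" by (rule free_seriesD)
    moreover have "(\<lambda>k. hom_part c k X) sums (\<Sum>k<2. hom_part c k X)"
      by (rule sums_finite) (auto simp: hom_part_def high)
    ultimately have "f X = (\<Sum>k<2. hom_part c k X)" by (rule sums_unique2)
    also have "\<dots> = cscale (c []) id_blinfun + (\<Sum>j\<in>UNIV. cscale (c [j]) (X $ j))"
      using hom_part_1[of c X] by (simp add: numeral_2_eq_2 hom_part_0)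
    also have "(\<Sum>j\<in>UNIV. cscale (c [j]) (X $ j)) = (\<Sum>j\<in>{i}. cscale (c [j]) (X $ j))"
      by (rule sum.mono_neutral_right)
        (auto simp: X_def Y_def)
    finally show ?thesis by simp
  qed
  then show ?thesis using that r Xi nil by (simp add: X_def)
qed

section \<open>From normality to a linear map\<close>

lemma H2_normal_imp_tuple_mult:
  fixes \<phi> :: "('h \<Rightarrow>\<^sub>L 'h) ^ 'n::finite \<Rightarrow> ('h \<Rightarrow>\<^sub>L 'h) ^ 'n"
  assumes normal: "H2_normal (comp_op \<phi>)"
  obtains A where "normal_matrix A" "\<And>X. X \<in> nc_ball \<Longrightarrow> \<phi> X = tuple_mult X A"
proof -
  obtain S where bT: "H2_bounded_op (comp_op \<phi>)" and adj: "H2_is_adjoint (comp_op \<phi>) S"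
    and comm: "\<And>f. f \<in> H2_ball \<Longrightarrow> S (comp_op \<phi> f) = comp_op \<phi> (S f)"
    using normal by (auto simp: H2_normal_def)
  define T where "T = comp_op \<phi>"
  define e :: "'n list \<Rightarrow> ('h \<Rightarrow>\<^sub>L 'h) ^ 'n \<Rightarrow> ('h \<Rightarrow>\<^sub>L 'h)" where "e \<alpha> = of_coeff (monomial \<alpha>)" for \<alpha>
  have e: "e \<alpha> \<in> H2_ball" for \<alpha>
    unfolding e_def by (intro of_coeff_in_H2 l2_monomial)
  have T: "T f \<in> H2_ball" "S f \<in> H2_ball" if "f \<in> H2_ball" for f
    using bT adj that by (auto simp: T_def H2_is_adjoint_def H2_bounded_op_def)
  have adjoint: "H2_inner (T f) g = H2_inner f (S g)" if "f \<in> H2_ball" "g \<in> H2_ball" for f g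
    using adj that by (simp add: T_def H2_is_adjoint_def)
  \<comment> \<open>Polarized form of the equality of norms. The case \<open>f = g\<close> yields
    the vanishing of coefficients, the mixed case the normality of the matrix.\<close>
  have inner_eq: "H2_inner (T f) (T g) = H2_inner (S f) (S g)" if "f \<in> H2_ball" "g \<in> H2_ball" for f g
  proof -
    have "H2_inner (T f) (T g) = H2_inner f (S (T g))" using that by (simp add: adjoint T)
    also have "\<dots> = cnj (H2_inner (T (S g)) f)"
      using that comm[of g] by (subst H2_inner_commute) (simp add: T_def)
    also have "\<dots> = H2_inner (S f) (S g)"
      using that by (simp add: adjoint T) (rule H2_inner_commute[symmetric])
    finally show ?thesis .
  qed
  \<comment> \<open>\<open>b \<alpha>\<close> and \<open>s \<alpha>\<close> are the columns, in the
    basis of monomials, of the composition operator and of its adjoint;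
    \<open>b \<alpha> \<beta>\<close> is the coefficient of \<beta> in the product of the components
    of \<phi> along \<alpha>.\<close>
  define b where "b \<alpha> = free_coeff (T (e \<alpha>))" for \<alpha>
  define s where "s \<alpha> = free_coeff (S (e \<alpha>))" for \<alpha>
  have l2: "l2 (b \<alpha>)" "l2 (s \<alpha>)" for \<alpha>
    unfolding b_def s_def by (intro H2_ball_series T e)+
  have series: "has_free_series (T (e \<alpha>)) (b \<alpha>)" for \<alpha>
    unfolding b_def by (intro H2_ball_series T e)
  have s: "s \<beta> \<alpha> = cnj (b \<alpha> \<beta>)" for \<alpha> \<beta>
  proof -
    have "b \<alpha> \<beta> = H2_inner (T (e \<alpha>)) (e \<beta>)"
      by (simp add: b_def e_def H2_inner_monomial)
    also have "\<dots> = cnj (H2_inner (S (e \<beta>)) (e \<alpha>))"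
      using adjoint[OF e e] H2_inner_commute by metis
    also have "\<dots> = cnj (s \<beta> \<alpha>)"
      by (simp add: s_def e_def H2_inner_monomial)
    finally show ?thesis by simp
  qed
  have inner_coeff: "(\<Sum>\<^sub>\<infinity>\<gamma>. b \<alpha> \<gamma> * cnj (b \<beta> \<gamma>)) = (\<Sum>\<^sub>\<infinity>\<gamma>. s \<alpha> \<gamma> * cnj (s \<beta> \<gamma>))" for \<alpha> \<beta>
    using inner_eq[OF e e, of \<alpha> \<beta>] by (simp add: H2_inner_def b_def s_def)
  have norm_coeff: "(\<Sum>\<^sub>\<infinity>\<gamma>. (cmod (b \<alpha> \<gamma>))\<^sup>2) = (\<Sum>\<^sub>\<infinity>\<gamma>. (cmod (s \<alpha> \<gamma>))\<^sup>2)" for \<alpha>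
    using inner_eq[OF e e, of \<alpha> \<alpha>]
    by (simp add: H2_inner_self T e b_def s_def of_real_eq_iff)
  have T_e: "T (e \<alpha>) X = word_prod (\<phi> X) \<alpha>" if "X \<in> nc_ball" for \<alpha> X
    using that by (simp add: T_def e_def comp_op_monomial)

  have "T (e []) = e []"
    by (simp add: T_def e_def comp_op_monomial) (simp add: of_coeff_monomial)
  then have b_Nil: "b [] = monomial []"
    by (simp add: b_def e_def free_coeff_of_coeff[OF l2_monomial])
  \<comment> \<open>The constant 1 is fixed by composition, so its image under the adjoint also has
    norm 1. The entry \<open>s [] []\<close> already uses up this norm, and the other entries of
    \<open>s []\<close> vanish; they are the conjugated constant terms.\<close>
  have b_const: "b \<alpha> [] = 0" if "\<alpha> \<noteq> []" for \<alpha>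
  proof -
    have "(\<Sum>\<gamma>\<in>{[], \<alpha>}. (cmod (s [] \<gamma>))\<^sup>2) \<le> (\<Sum>\<^sub>\<infinity>\<gamma>. (cmod (s [] \<gamma>))\<^sup>2)"
      by (intro l2_words_le l2) simp
    also have "\<dots> = (\<Sum>\<gamma>\<in>{[]}. (cmod (b [] \<gamma>))\<^sup>2)"
      unfolding norm_coeff[symmetric] by (rule infsum_finite_support) (auto simp: b_Nil monomial_def)
    finally show ?thesis using that by (simp add: s b_Nil monomial_def)
  qed

  \<comment> \<open>At the nilpotent tuple every component of \<phi> is a scalar multiple of
    \<open>X $ i\<close>, as the constant terms vanish. A product of two components is then zero,
    while it also equals the linear coefficient times \<open>X $ i\<close>. The rule for
    \<open>remdups_adj\<close> splits words into empty, one letter, and at least two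
    letters.\<close>
  have b_deg_1: "b \<alpha> [i] = 0" if "length \<alpha> \<noteq> 1" for \<alpha> i
  proof (cases \<alpha> rule: remdups_adj.cases)
    case (3 j l \<beta>)
    obtain X :: "('h \<Rightarrow>\<^sub>L 'h) ^ 'n" where X: "X \<in> nc_ball" "X $ i \<noteq> 0" "X $ i o\<^sub>L X $ i = 0"
      "\<And>f c. has_free_series f c \<Longrightarrow> f X = cscale (c []) id_blinfun + cscale (c [i]) (X $ i)"
      by (rule nilpotent_tuple[of i]) (rule that)
    have at_X: "word_prod (\<phi> X) \<gamma> = cscale (b \<gamma> [i]) (X $ i)" if "\<gamma> \<noteq> []" for \<gamma>
      using X(4)[OF series[of \<gamma>]] that by (simp add: T_e X(1) b_const)
    have "\<phi> X $ j o\<^sub>L \<phi> X $ l = 0"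
    proof -
      have "\<phi> X $ k = cscale (b [k] [i]) (X $ i)" for k using at_X[of "[k]"] by simp
      moreover have "blinfun_apply (X $ i) (scaleC z (blinfun_apply (X $ i) h)) = 0" for z h
      proof -
        have "blinfun_apply (X $ i) (blinfun_apply (X $ i) h) = 0"
          using X(3) by (metis blinfun_apply_blinfun_compose zero_blinfun.rep_eq)
        then show ?thesis
          using X(1) by (simp add: nc_ball_def cblinops_def)
      qed
      ultimately show ?thesis
        by (intro blinfun_eqI) (simp add: cscale.rep_eq)
    qed
    then have "word_prod (\<phi> X) \<alpha> = 0" by (simp add: 3 blinfun_compose_assoc)
    then have "cscale (b \<alpha> [i]) (X $ i) = 0" using at_X[of \<alpha>] 3 by simp
    moreover obtain h where "blinfun_apply (X $ i) h \<noteq> 0"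
      using X(2) by (metis blinfun_eqI zero_blinfun.rep_eq)
    ultimately have "cmod (b \<alpha> [i]) * norm (blinfun_apply (X $ i) h) = 0"
      by (metis cscale.rep_eq norm_scaleC norm_zero zero_blinfun.rep_eq)
    then show ?thesis using \<open>blinfun_apply (X $ i) h \<noteq> 0\<close> by simp
  qed (use that b_Nil in \<open>auto simp: monomial_def\<close>)

  \<comment> \<open>By \<open>b_deg_1\<close>, the adjoint maps a linear monomial to a linear
    function, so sums against \<open>s [i]\<close> reduce to single letters.\<close>
  have s_sum: "(\<Sum>\<^sub>\<infinity>\<gamma>. s [i] \<gamma> * F \<gamma>) = (\<Sum>j\<in>UNIV. s [i] [j] * F [j])" for i and F :: "'n list \<Rightarrow> complex"
  proof -
    have "(\<Sum>\<^sub>\<infinity>\<gamma>. s [i] \<gamma> * F \<gamma>) = (\<Sum>\<gamma> | length \<gamma> = 1. s [i] \<gamma> * F \<gamma>)"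
      using b_deg_1 by (intro infsum_finite_support finite_words) (auto simp: s)
    then show ?thesis by (simp only: sum_words_1)
  qed

  have b_deg: "b [i] \<beta> = 0" if "length \<beta> \<noteq> 1" for i \<beta>
  proof -
    \<comment> \<open>\<open>D i\<close> is the squared norm of the part of the i-th component of
      \<phi> outside degree one, so it dominates the single term at \<beta>.\<close>
    define D where "D i = (\<Sum>\<^sub>\<infinity>\<gamma>. (cmod (b [i] \<gamma>))\<^sup>2) - (\<Sum>j\<in>UNIV. (cmod (b [i] [j]))\<^sup>2)" for i
    have bound: "(\<Sum>\<gamma>\<in>insert \<beta> {\<gamma>. length \<gamma> = 1}. (cmod (b [i] \<gamma>))\<^sup>2) \<le> (\<Sum>\<^sub>\<infinity>\<gamma>. (cmod (b [i] \<gamma>))\<^sup>2)" for i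
      by (intro l2_words_le l2) (rule finite.insertI, rule finite_words)
    have D: "(cmod (b [i] \<beta>))\<^sup>2 \<le> D i" for i
    proof -
      have "(\<Sum>\<gamma>\<in>insert \<beta> {\<gamma>. length \<gamma> = 1}. (cmod (b [i] \<gamma>))\<^sup>2) =
          (cmod (b [i] \<beta>))\<^sup>2 + (\<Sum>\<gamma> | length \<gamma> = 1. (cmod (b [i] \<gamma>))\<^sup>2)"
        using that by (intro sum.insert finite_words) simp
      then show ?thesis
        using bound[of i] unfolding D_def sum_words_1 by linarith
    qed
    have "(\<Sum>\<^sub>\<infinity>\<gamma>. (cmod (b [i] \<gamma>))\<^sup>2) = (\<Sum>j\<in>UNIV. (cmod (b [j] [i]))\<^sup>2)" for i
    proof -
      have "(\<Sum>\<^sub>\<infinity>\<gamma>. (cmod (s [i] \<gamma>))\<^sup>2) = (\<Sum>\<gamma> | length \<gamma> = 1. (cmod (s [i] \<gamma>))\<^sup>2)"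
        using b_deg_1 by (intro infsum_finite_support finite_words) (auto simp: s)
      then show ?thesis unfolding norm_coeff sum_words_1 by (simp add: s)
    qed
    \<comment> \<open>The norm equality compares a row of the array \<open>b [j] [i]\<close> with a
      column, so an individual \<open>D i\<close> need not cancel directly. Summed over
      \<open>i\<close>, rows and columns have the same total, and nonnegativity forces each
      \<open>D i\<close> to vanish.\<close>
    then have "(\<Sum>i\<in>UNIV. D i) =
        (\<Sum>i\<in>UNIV. \<Sum>j\<in>UNIV. (cmod (b [j] [i]))\<^sup>2) - (\<Sum>i\<in>UNIV. \<Sum>j\<in>UNIV. (cmod (b [i] [j]))\<^sup>2)"
      by (simp add: D_def sum_subtractf)
    also have "\<dots> = 0" using sum.swap[of "\<lambda>i j. (cmod (b [j] [i]))\<^sup>2" UNIV UNIV] by simp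
    finally have "D i = 0"
      using D order_trans[OF zero_le_power2] by (subst (asm) sum_nonneg_eq_0_iff) auto
    then show ?thesis using D[of i] by simp
  qed

  \<comment> \<open>Column \<open>j\<close> holds the linear coefficients of the j-th component,
    matching the row-tuple convention of \<open>tuple_mult\<close>.\<close>
  define A :: "complex ^ 'n ^ 'n" where "A = (\<chi> i j. b [j] [i])"
  have "\<phi> X = tuple_mult X A" if X: "X \<in> nc_ball" for X
  proof (rule vec_eq_iff[THEN iffD2], rule allI)
    fix j
    have "(\<lambda>k. hom_part (b [j]) k X) sums \<phi> X $ j"
      using free_seriesD[OF series[of "[j]"] X] by (simp add: T_e X)
    moreover have "(\<lambda>k. hom_part (b [j]) k X) sums (\<Sum>k\<in>{1}. hom_part (b [j]) k X)"
      by (rule sums_finite) (auto simp: hom_part_def b_deg)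
    ultimately have "\<phi> X $ j = hom_part (b [j]) 1 X" using sums_unique2 by fastforce
    then show "\<phi> X $ j = tuple_mult X A $ j" by (simp only: hom_part_1 tuple_mult_def A_def vec_lambda_beta)
  qed
  moreover have "normal_matrix A"
  proof -
    \<comment> \<open>Entry (i, j) of the two products of \<open>A\<close> with its adjoint:
      \<open>inner_coeff\<close> for the words \<open>[j]\<close> and \<open>[i]\<close>, where both
      sides live in degree one.\<close>
    have "(\<Sum>l\<in>UNIV. b [j] [l] * cnj (b [i] [l])) = (\<Sum>l\<in>UNIV. b [l] [i] * cnj (b [l] [j]))" for i j
    proof -
      have "(\<Sum>l\<in>UNIV. b [j] [l] * cnj (b [i] [l])) = (\<Sum>\<^sub>\<infinity>\<gamma>. b [j] \<gamma> * cnj (b [i] \<gamma>))"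
        using b_deg infsum_finite_support[OF finite_words[of 1], of "\<lambda>\<gamma>. b [j] \<gamma> * cnj (b [i] \<gamma>)"]
        unfolding sum_words_1 by simp
      also have "\<dots> = (\<Sum>l\<in>UNIV. b [l] [i] * cnj (b [l] [j]))"
        unfolding inner_coeff s_sum by (simp add: s mult.commute)
      finally show ?thesis .
    qed
    then show ?thesis
      by (simp add: normal_matrix_def matrix_matrix_mult_def conj_transpose_def map_matrix_def transpose_def
          vec_eq_iff A_def mult.commute)
  qed
  ultimately show ?thesis by (rule that[rotated])
qed

end

theorem theorem4p2:
  fixes \<phi> :: "('h::complex_hilbert \<Rightarrow>\<^sub>L 'h) ^ 'n::finite \<Rightarrow> ('h \<Rightarrow>\<^sub>L 'h) ^ 'n"
  assumes separable: "separable_space (euclidean :: 'h topology)"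
    and infinite_dim: "\<And>B :: 'h set. finite B \<Longrightarrow> module.span scaleC B \<noteq> UNIV"
    and self_map: "free_holomorphic_self_map \<phi>"
  shows "H2_normal (comp_op \<phi>) \<longleftrightarrow>
    (\<exists>A :: complex ^ 'n ^ 'n. normal_matrix A \<and> onorm ((*v) A) \<le> 1 \<and>
       (\<forall>X\<in>nc_ball. \<phi> X = tuple_mult X A))"
proof
  have inf: "\<forall>B :: 'h set. finite B \<longrightarrow> module.span scaleC B \<noteq> UNIV"
    using infinite_dim by blast
  {
    assume "H2_normal (comp_op \<phi>)"
    then obtain A where A: "normal_matrix A" "\<And>X. X \<in> nc_ball \<Longrightarrow> \<phi> X = tuple_mult X A"
      by (rule H2_normal_imp_tuple_mult[OF inf]) (rule that)
    \<comment> \<open>The self-map property passes from \<phi> to the linear tuple and bounds the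
      norm of \<open>A\<close>.\<close>
    have "tuple_mult X A \<in> nc_ball" if "X \<in> nc_ball" for X :: "('h \<Rightarrow>\<^sub>L 'h) ^ 'n"
      using self_map that A(2) by (auto simp: free_holomorphic_self_map_def)
    then have "norm (A *v v) \<le> norm v" for v
      by (rule nc_ball_contraction[OF inf A(1)])
    then have "onorm ((*v) A) \<le> 1" by (intro onorm_bound) simp_all
    with A show "\<exists>A :: complex ^ 'n ^ 'n. normal_matrix A \<and> onorm ((*v) A) \<le> 1 \<and>
       (\<forall>X\<in>nc_ball. \<phi> X = tuple_mult X A)" by blast
  next
    assume "\<exists>A :: complex ^ 'n ^ 'n. normal_matrix A \<and> onorm ((*v) A) \<le> 1 \<and>
       (\<forall>X\<in>nc_ball. \<phi> X = tuple_mult X A)"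
    then obtain A :: "complex ^ 'n ^ 'n" where A: "normal_matrix A" "onorm ((*v) A) \<le> 1"
      "\<And>X. X \<in> nc_ball \<Longrightarrow> \<phi> X = tuple_mult X A" by blast
    have "norm (A *v v) \<le> norm v" for v
      using onorm[OF matrix_vector_mul_bounded_linear, of A v] mult_right_mono[OF A(2) norm_ge_zero[of v]]
      by simp
    then show "H2_normal (comp_op \<phi>)"
      using H2_normal_tuple_mult[OF inf A(1) _ A(3)] by blast
  }
qed

end
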